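(* The flying block puzzle (with no bound on the number of times each piece may be moved) can be solved in polynomial time on instances in which the frame is a rectangle of width $1$.
   Context: A polyomino is a polygon formed by joining one or more unit squares edge to edge. A feasible packing of a set of polyominoes (pieces) into a polyomino $F$ (the frame) is an arrangement of all pieces inside $F$ with no two overlapping (except along edges and vertices), all piece vertices on grid points of $F$, and all piece edges parallel or perpendicular to the edges of $F$. A fly of a piece consists of picking it up, translating and/or rotating it (but not turning it over) as desired, and putting it back so that the result is a feasible packing. The flying block puzzle: given a set of pieces, a frame $F$, an initial feasible packing, a specified piece $P$, and a goal position of $P$ in $F$, decide whether there is a finite sequence of flies, starting from the initial packing, that brings $P$ to the goal position. *)

theory Defs
  imports Main "HOL-Library.Product_Lexorder"
begin

type_synonym cell = "int \<times> int"

definition adjacent :: "cell \<Rightarrow> cell \<Rightarrow> bool" where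
  "adjacent c d \<longleftrightarrow> \<bar>fst c - fst d\<bar> + \<bar>snd c - snd d\<bar> = 1"

definition polyomino :: "cell set \<Rightarrow> bool" where
  "polyomino S \<longleftrightarrow> finite S \<and> S \<noteq> {} \<and>
     (\<forall>c\<in>S. \<forall>d\<in>S. (\<lambda>u v. u \<in> S \<and> v \<in> S \<and> adjacent u v)\<^sup>*\<^sup>* c d)"

definition rot90 :: "cell \<Rightarrow> cell" where
  "rot90 c = (- snd c, fst c)"

definition placement_of :: "cell set \<Rightarrow> cell set \<Rightarrow> bool" where
  "placement_of S T \<longleftrightarrow>
     (\<exists>k::nat. k < 4 \<and> (\<exists>a b::int. T = (\<lambda>c. (fst ((rot90 ^^ k) c) + a, snd ((rot90 ^^ k) c) + b)) ` S))"

definition feasible :: "cell set \<Rightarrow> cell set list \<Rightarrow> bool" where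
  "feasible F cs \<longleftrightarrow> (\<forall>i < length cs. cs ! i \<subseteq> F) \<and>
     (\<forall>i < length cs. \<forall>j < length cs. i \<noteq> j \<longrightarrow> cs ! i \<inter> cs ! j = {})"

definition fly :: "cell set \<Rightarrow> cell set list \<Rightarrow> cell set list \<Rightarrow> bool" where
  "fly F cs cs' \<longleftrightarrow> length cs' = length cs \<and> feasible F cs' \<and>
     (\<exists>i < length cs. placement_of (cs ! i) (cs' ! i) \<and>
        (\<forall>j < length cs. j \<noteq> i \<longrightarrow> cs' ! j = cs ! j))"

text \<open>An instance: (frame, initial packing (list of piece positions), index of the special piece P,
  goal position of P).\<close>
type_synonym puzzle_instance = "cell set \<times> cell set list \<times> nat \<times> cell set"

definition valid_instance :: "puzzle_instance \<Rightarrow> bool" where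
  "valid_instance I = (case I of (F, init, p, goal) \<Rightarrow>
     polyomino F \<and> (\<forall>P \<in> set init. polyomino P) \<and> feasible F init \<and>
     p < length init \<and> placement_of (init ! p) goal)"

definition width1_rectangle :: "cell set \<Rightarrow> bool" where
  "width1_rectangle F \<longleftrightarrow> (\<exists>a b::int. \<exists>n::int. n \<ge> 1 \<and>
     (F = {a..<a+n} \<times> {b} \<or> F = {a} \<times> {b..<b+n}))"

definition solvable :: "puzzle_instance \<Rightarrow> bool" where
  "solvable I = (case I of (F, init, p, goal) \<Rightarrow>
     (\<exists>cs. (fly F)\<^sup>*\<^sup>* init cs \<and> cs ! p = goal))"

fun enc_nat :: "nat \<Rightarrow> bool list" where
  "enc_nat n = (if n = 0 then [False] else True # odd n # enc_nat (n div 2))"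

definition enc_int :: "int \<Rightarrow> bool list" where
  "enc_int k = (k < 0) # enc_nat (nat \<bar>k\<bar>)"

definition enc_list :: "('a \<Rightarrow> bool list) \<Rightarrow> 'a list \<Rightarrow> bool list" where
  "enc_list e xs = concat (map (\<lambda>x. True # e x) xs) @ [False]"

definition enc_cell :: "cell \<Rightarrow> bool list" where
  "enc_cell c = enc_int (fst c) @ enc_int (snd c)"

definition enc_cellset :: "cell set \<Rightarrow> bool list" where
  "enc_cellset S = enc_list enc_cell (sorted_list_of_set S)"

definition enc_instance :: "puzzle_instance \<Rightarrow> bool list" where
  "enc_instance I = (case I of (F, init, p, goal) \<Rightarrow>
     enc_cellset F @ enc_list enc_cellset init @ enc_nat p @ enc_cellset goal)"

text \<open>States 0..<Q (0 = start, 1 = accept, 2 = reject), tape symbols 0..<S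
  (0 = blank, 1 = input bit False, 2 = input bit True); moves -1, 0, 1.\<close>
record tm =
  tm_states :: nat
  tm_symbols :: nat
  tm_delta :: "nat \<Rightarrow> nat \<Rightarrow> nat \<times> nat \<times> int"

definition tm_wf :: "tm \<Rightarrow> bool" where
  "tm_wf M \<longleftrightarrow> tm_states M \<ge> 3 \<and> tm_symbols M \<ge> 3 \<and>
     (\<forall>q < tm_states M. \<forall>s < tm_symbols M. case tm_delta M q s of (q', s', m) \<Rightarrow>
        q' < tm_states M \<and> s' < tm_symbols M \<and> m \<in> {-1, 0, 1})"

type_synonym tm_config = "nat \<times> (int \<Rightarrow> nat) \<times> int"

definition tm_step :: "tm \<Rightarrow> tm_config \<Rightarrow> tm_config" where
  "tm_step M cfg = (case cfg of (q, tp, h) \<Rightarrow>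
     if q = 1 \<or> q = 2 then (q, tp, h)
     else (case tm_delta M q (tp h) of (q', s', m) \<Rightarrow> (q', tp(h := s'), h + m)))"

definition tm_init :: "bool list \<Rightarrow> tm_config" where
  "tm_init w = (0, (\<lambda>i. if 0 \<le> i \<and> i < int (length w) then (if w ! nat i then 2 else 1) else 0), 0)"

definition tm_run :: "tm \<Rightarrow> bool list \<Rightarrow> nat \<Rightarrow> tm_config" where
  "tm_run M w t = (tm_step M ^^ t) (tm_init w)"

definition tm_answers_within :: "tm \<Rightarrow> bool list \<Rightarrow> nat \<Rightarrow> bool \<Rightarrow> bool" where
  "tm_answers_within M w t b \<longleftrightarrow> fst (tm_run M w t) = (if b then 1 else 2)"

end

theory Submission
  imports Defs
begin

text \<open>In a frame of width 1 and length n every piece is an interval. Let f be the free length, and call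
  a piece large if it is longer than f. A gap is never longer than f, so large pieces never jump over
  one another. Conversely, two packings in the same order are connected through their pointwise
  minimum, and collecting all the free space into one gap lets any other piece fly there, so every
  packing that keeps the order of the large pieces can be reached. Whether a start position of P is
  reachable then depends only on a few sums of piece lengths.

  All numbers in this criterion are bounded by the length of the input, because the encoding lists the
  cells of the frame one by one, and the offset of a piece is the index at which its first cell occurs
  in the list of cells of the frame. So the criterion can be evaluated with finitely many pointers into
  the input, by programs closed under primitive recursion with values truncated at the input length.
  A Turing machine simulates such a program by marking the cells to which the pointers point. Its
  running time needs no analysis: there are only polynomially many configurations, and a computation
  that halts repeats none of them.\<close>

section \<open>Intervals on a line\<close>

lemma sum_lengths_disjoint_intervals:
  fixes s l :: "nat \<Rightarrow> nat"
  assumes "finite X" and "\<And>i. i \<in> X \<Longrightarrow> a \<le> s i \<and> s i + l i \<le> b"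
    and "\<And>i j. i \<in> X \<Longrightarrow> j \<in> X \<Longrightarrow> i \<noteq> j \<Longrightarrow> s i + l i \<le> s j \<or> s j + l j \<le> s i"
  shows "sum l X \<le> b - a"
proof -
  have "sum l X = (\<Sum>i\<in>X. card {s i..<s i + l i})" by simp
  also have "\<dots> = card (\<Union>i\<in>X. {s i..<s i + l i})"
  proof (rule card_UN_disjoint[symmetric])
    show "\<forall>i\<in>X. \<forall>j\<in>X. i \<noteq> j \<longrightarrow> {s i..<s i + l i} \<inter> {s j..<s j + l j} = {}"
      using assms(3) by fastforce
  qed (use assms(1) in auto)
  also have "\<dots> \<le> card {a..<b}"
    using assms(2) by (intro card_mono) fastforce+
  finally show ?thesis by simp
qed

lemma greedy_subset_sum:
  fixes l :: "nat \<Rightarrow> nat"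
  assumes "finite X" "\<And>i. i \<in> X \<Longrightarrow> l i \<le> f" "a \<le> y" "y \<le> a + sum l X + f"
  shows "\<exists>B\<subseteq>X. a + sum l B \<le> y \<and> y \<le> a + sum l B + f"
  using assms
proof (induction X rule: finite_induct)
  case (insert x X)
  show ?case
  proof (cases "y \<le> a + sum l X + f")
    case True
    then obtain B where "B \<subseteq> X" "a + sum l B \<le> y" "y \<le> a + sum l B + f"
      using insert by auto
    then show ?thesis by blast
  next
    case False
    moreover have "l x \<le> f" using insert.prems by auto
    ultimately have "a + sum l (insert x X) \<le> y" using insert.hyps by simp
    then show ?thesis using insert.prems by blast
  qed
qed auto

locale line =
  fixes n m :: nat and l :: "nat \<Rightarrow> nat"
  assumes l_pos: "i < m \<Longrightarrow> 0 < l i"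
    and m_pos: "0 < m"
begin

definition apart :: "(nat \<Rightarrow> nat) \<Rightarrow> nat \<Rightarrow> nat \<Rightarrow> bool" where
  "apart s i j \<longleftrightarrow> s i + l i \<le> s j \<or> s j + l j \<le> s i"

definition fits :: "(nat \<Rightarrow> nat) \<Rightarrow> bool" where
  "fits s \<longleftrightarrow> (\<forall>i<m. s i + l i \<le> n) \<and> (\<forall>i<m. \<forall>j<m. i \<noteq> j \<longrightarrow> apart s i j)"

definition hop :: "(nat \<Rightarrow> nat) \<Rightarrow> (nat \<Rightarrow> nat) \<Rightarrow> bool" where
  "hop s t \<longleftrightarrow> fits t \<and> (\<exists>i<m. \<forall>j<m. j \<noteq> i \<longrightarrow> t j = s j)"

definition slack :: nat where
  "slack = n - sum l {..<m}"

definition large :: "nat set" where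
  "large = {i. i < m \<and> slack < l i}"

lemma fits_less: "fits s \<Longrightarrow> i < m \<Longrightarrow> j < m \<Longrightarrow> s i < s j \<Longrightarrow> s i + l i \<le> s j"
  unfolding fits_def apart_def using l_pos by (metis add_leD1 leD order_less_irrefl)

lemma fits_inj: "fits s \<Longrightarrow> i < m \<Longrightarrow> j < m \<Longrightarrow> s i = s j \<Longrightarrow> i = j"
  unfolding fits_def apart_def using l_pos by (metis add_le_same_cancel1 leD)

lemma fits_end: "fits s \<Longrightarrow> i < m \<Longrightarrow> s i + l i \<le> n"
  unfolding fits_def by blast

lemma fits_apart: "fits s \<Longrightarrow> i < m \<Longrightarrow> j < m \<Longrightarrow> i \<noteq> j \<Longrightarrow> apart s i j"
  unfolding fits_def by blast

lemma fits_linear: "fits s \<Longrightarrow> i < m \<Longrightarrow> j < m \<Longrightarrow> i \<noteq> j \<Longrightarrow> s i < s j \<or> s j < s i"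
  using fits_inj by (meson linorder_neqE_nat)

lemma fitsI:
  assumes "\<And>i. i < m \<Longrightarrow> s i + l i \<le> n"
    and "\<And>i j. i < m \<Longrightarrow> j < m \<Longrightarrow> i \<noteq> j \<Longrightarrow> apart s i j"
  shows "fits s"
  using assms unfolding fits_def by blast

lemma apart_sym: "apart s i j \<Longrightarrow> apart s j i"
  unfolding apart_def by blast

lemma fits_total_length: "fits s \<Longrightarrow> sum l {..<m} \<le> n"
  using sum_lengths_disjoint_intervals[of "{..<m}" 0 s l n] unfolding fits_def apart_def by auto

lemma hops_fits: "hop\<^sup>*\<^sup>* s t \<Longrightarrow> fits s \<Longrightarrow> fits t"
  by (induction rule: rtranclp_induct) (auto simp: hop_def)

lemma hops_sym: "hop\<^sup>*\<^sup>* s t \<Longrightarrow> fits s \<Longrightarrow> hop\<^sup>*\<^sup>* t s"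
proof (induction rule: rtranclp_induct)
  case (step t u)
  then have "fits t" using hops_fits by blast
  moreover obtain i where "i < m" "\<forall>j<m. j \<noteq> i \<longrightarrow> u j = t j" using step(2) hop_def by auto
  ultimately have "hop u t" unfolding hop_def by metis
  then show ?case using step by (meson converse_rtranclp_into_rtranclp)
qed auto

lemma hops_down:
  assumes "fits s" "fits u" "\<And>i. i < m \<Longrightarrow> u i \<le> s i"
    and "\<And>i j. i < m \<Longrightarrow> j < m \<Longrightarrow> s i < s j \<Longrightarrow> u i < u j"
  shows "hop\<^sup>*\<^sup>* s u"
  using assms
proof (induction "card {i. i < m \<and> u i \<noteq> s i}" arbitrary: s rule: less_induct)
  case less
  let ?D = "{i. i < m \<and> u i \<noteq> s i}"
  show ?case
  proof (cases "?D = {}")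
    case True
    then have "hop s u" unfolding hop_def using m_pos less.prems(2) by auto
    then show ?thesis by blast
  next
    case False
    define i where "i = arg_min_on s ?D"
    have fin: "finite ?D" by simp
    have i: "i \<in> ?D" unfolding i_def using arg_min_if_finite(1)[OF fin False] .
    have min: "s i \<le> s j" if "j \<in> ?D" for j
      using arg_min_least[OF fin False that] unfolding i_def .
    define t where "t = s(i := u i)"
    have ap: "apart t i j" if j: "j < m" "j \<noteq> i" for j
    proof (cases "s j < s i")
      case True
      then have "u j = s j" using min j by fastforce
      moreover have "u j < u i" using less.prems(4) True i j by auto
      ultimately show ?thesis using fits_less[OF less.prems(2), of j i] i j
        unfolding apart_def t_def by simp
    next
      case False
      then have "s i + l i \<le> s j"
        using fits_less[OF less.prems(1), of i j] fits_linear[OF less.prems(1), of i j] i j by auto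
      then show ?thesis using less.prems(3)[of i] i j unfolding apart_def t_def by simp
    qed
    have ft: "fits t"
    proof (rule fitsI)
      fix j assume "j < m"
      then show "t j + l j \<le> n" using less.prems(1,2) unfolding t_def fits_def by simp
    next
      fix j k assume jk: "j < m" "k < m" "j \<noteq> k"
      show "apart t j k"
      proof (cases "j = i \<or> k = i")
        case True
        then show ?thesis using ap[of j] ap[of k] jk apart_sym[of t i] by auto
      next
        case False
        then show ?thesis using less.prems(1) jk unfolding fits_def apart_def t_def by auto
      qed
    qed
    moreover have "\<forall>j<m. j \<noteq> i \<longrightarrow> t j = s j" unfolding t_def by simp
    ultimately have "hop s t" unfolding hop_def using i by blast
    moreover have "hop\<^sup>*\<^sup>* t u"
    proof (rule less.hyps)
      have "{j. j < m \<and> u j \<noteq> t j} = ?D - {i}" unfolding t_def by auto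
      then show "card {j. j < m \<and> u j \<noteq> t j} < card ?D"
        using i fin by (metis (lifting) card_Diff1_less)
      show "fits t" by fact
      show "fits u" by fact
      show "u j \<le> t j" if "j < m" for j using that less.prems(3)[of j] unfolding t_def by simp
      show "u j < u k" if jk: "j < m" "k < m" "t j < t k" for j k
      proof (rule ccontr)
        assume no: "\<not> u j < u k"
        then have "\<not> s j < s k" using less.prems(4) jk by blast
        moreover have "j \<noteq> k" using jk(3) by auto
        ultimately have "s k < s j" using fits_linear[OF less.prems(1), of j k] jk by blast
        then have "u k < u j" using less.prems(4) jk by blast
        consider "j = i" | "k = i" | "j \<noteq> i" "k \<noteq> i" by blast
        then show False
        proof cases
          case 1
          then have "u k = s k" using min[of k] \<open>s k < s j\<close> jk(2) by fastforce
          then show False using 1 jk(3) \<open>u k < u j\<close> \<open>j \<noteq> k\<close> unfolding t_def by simp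
        next
          case 2
          then show False using jk(3) \<open>s k < s j\<close> \<open>j \<noteq> k\<close> less.prems(3)[OF jk(2)] unfolding t_def by simp
        next
          case 3
          then show False using jk(3) \<open>s k < s j\<close> unfolding t_def by simp
        qed
      qed
    qed
    ultimately show ?thesis by (meson converse_rtranclp_into_rtranclp)
  qed
qed

text \<open>Two arrangements in the same order both slide down to their pointwise minimum.\<close>

lemma hops_same_order:
  assumes s: "fits s" and t: "fits t"
    and ord: "\<And>i j. i < m \<Longrightarrow> j < m \<Longrightarrow> s i < s j \<longleftrightarrow> t i < t j"
  shows "hop\<^sup>*\<^sup>* s t"
proof -
  define u where "u = (\<lambda>i. min (s i) (t i))"
  have "apart u i j" if ij: "i < m" "j < m" "i \<noteq> j" for i j
  proof -
    consider "s i < s j" | "s j < s i" using fits_linear[OF s ij] by blast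
    then show ?thesis
    proof cases
      case 1
      then have "s i + l i \<le> s j" "t i + l i \<le> t j" using fits_less s t ord ij by blast+
      then show ?thesis unfolding apart_def u_def by auto
    next
      case 2
      then have "s j + l j \<le> s i" "t j + l j \<le> t i" using fits_less s t ord ij by blast+
      then show ?thesis unfolding apart_def u_def by auto
    qed
  qed
  then have u: "fits u" using s unfolding fits_def u_def by fastforce
  have mono: "u i < u j" if "s i < s j" "i < m" "j < m" for i j
    using that ord[of i j] unfolding u_def by (auto simp: min_def)
  have "hop\<^sup>*\<^sup>* s u" using hops_down[OF s u] mono unfolding u_def by auto
  moreover have "hop\<^sup>*\<^sup>* t u" using hops_down[OF t u] mono ord unfolding u_def by auto
  then have "hop\<^sup>*\<^sup>* u t" using hops_sym t by blast
  ultimately show ?thesis by (rule rtranclp_trans)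
qed

text \<open>With all other pieces pushed to the two ends, all the free space is one gap, wherever wanted;
  a piece that is not large fits into it.\<close>

lemma hops_insert:
  assumes s: "fits s" and i: "i < m" "i \<notin> large"
  shows "\<exists>s'. hop\<^sup>*\<^sup>* s s' \<and> (\<forall>j<m. \<forall>k<m. j \<noteq> i \<longrightarrow> k \<noteq> i \<longrightarrow> (s' j < s' k \<longleftrightarrow> s j < s k))
    \<and> (\<forall>j<m. j \<noteq> i \<longrightarrow> (s' j < s' i \<longleftrightarrow> s j < y))"
proof -
  define pk where "pk = (\<lambda>z. \<Sum>k | k < m \<and> s k < z. l k)"
  have tot: "slack + sum l {..<m} = n" using fits_total_length[OF s] unfolding slack_def by auto
  have step: "pk (s j) + l j \<le> pk z" if "j < m" "s j < z" for j z
  proof -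
    have "pk (s j) + l j = sum l (insert j {k. k < m \<and> s k < s j})"
      unfolding pk_def by (subst sum.insert) auto
    also have "\<dots> \<le> pk z" unfolding pk_def using that by (intro sum_mono2) auto
    finally show ?thesis .
  qed
  have top: "pk z \<le> sum l {..<m}" for z unfolding pk_def by (intro sum_mono2) auto
  have pmono: "pk z \<le> pk z'" if "z \<le> z'" for z z' unfolding pk_def using that by (intro sum_mono2) auto
  define s1 where "s1 = (\<lambda>j. pk (s j) + (if s j < y then 0 else slack))"
  have less1: "s1 j + l j \<le> s1 k" if "j < m" "s j < s k" for j k
    using step[of j "s k"] that unfolding s1_def by auto
  have ord1: "s1 j < s1 k \<longleftrightarrow> s j < s k" if "j < m" "k < m" for j k
    using less1[of j k] less1[of k j] l_pos[of j] l_pos[of k] that fits_linear[OF s, of j k]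
    by (cases "j = k") auto
  have end1: "s1 j + l j \<le> n" if "j < m" for j
    using step[of j "Suc (s j)"] top[of "Suc (s j)"] that tot unfolding s1_def by (auto split: if_splits)
  have f1: "fits s1"
  proof (rule fitsI)
    fix j k assume "j < m" "k < m" "j \<noteq> k"
    then show "apart s1 j k" using less1[of j k] less1[of k j] fits_linear[OF s, of j k]
      unfolding apart_def by blast
  qed (rule end1)
  define s2 where "s2 = s1(i := pk y)"
  have li: "l i \<le> slack" using i unfolding large_def by auto
  have left: "s1 j + l j \<le> pk y" if "j < m" "s j < y" for j
    using step[OF that] that unfolding s1_def by auto
  have right: "pk y + slack \<le> s1 j" if "j < m" "\<not> s j < y" for j
    using pmono[of y "s j"] that unfolding s1_def by auto
  have ap: "apart s2 i j" if "j < m" "j \<noteq> i" for j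
    using left[of j] right[of j] that li unfolding apart_def s2_def by (cases "s j < y") auto
  have f2: "fits s2"
  proof (rule fitsI)
    fix j assume "j < m"
    then show "s2 j + l j \<le> n" using end1 top[of y] li tot unfolding s2_def by auto
  next
    fix j k assume jk: "j < m" "k < m" "j \<noteq> k"
    show "apart s2 j k"
    proof (cases "j = i \<or> k = i")
      case True
      then show ?thesis using ap jk apart_sym by blast
    next
      case False
      then show ?thesis using f1 jk unfolding fits_def apart_def s2_def by auto
    qed
  qed
  have "hop s1 s2" unfolding hop_def using f2 i unfolding s2_def by auto
  moreover have "hop\<^sup>*\<^sup>* s s1" using hops_same_order[OF s f1] ord1 by blast
  ultimately have "hop\<^sup>*\<^sup>* s s2" by auto
  moreover have "s2 j < s2 i \<longleftrightarrow> s j < y" if "j < m" "j \<noteq> i" for j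
    using left[of j] right[of j] l_pos[of j] that unfolding s2_def by (cases "s j < y") auto
  ultimately show ?thesis using ord1 unfolding s2_def by (intro exI[of _ s2]) (auto simp: s2_def)
qed

lemma hops_same_large_order:
  assumes s: "fits s" and t: "fits t"
    and ord: "\<And>i j. i \<in> large \<Longrightarrow> j \<in> large \<Longrightarrow> s i < s j \<longleftrightarrow> t i < t j"
  shows "hop\<^sup>*\<^sup>* s t"
proof -
  have "\<exists>s'. hop\<^sup>*\<^sup>* s s' \<and> (\<forall>i\<in>large \<union> X. \<forall>j\<in>large \<union> X. s' i < s' j \<longleftrightarrow> t i < t j)"
    if "finite X" "X \<subseteq> {..<m}" for X
    using that
  proof (induction X rule: finite_induct)
    case empty
    then show ?case using ord by auto
  next
    case (insert i X)
    then obtain s' where s': "hop\<^sup>*\<^sup>* s s'"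
      and o': "\<And>i j. i\<in>large \<union> X \<Longrightarrow> j\<in>large \<union> X \<Longrightarrow> s' i < s' j \<longleftrightarrow> t i < t j" by auto
    have f': "fits s'" using hops_fits s' s by blast
    show ?case
    proof (cases "i \<in> large")
      case True
      then have "large \<union> insert i X = large \<union> X" by auto
      then show ?thesis using s' o' by metis
    next
      case False
      have im: "i < m" using insert by auto
      let ?K = "large \<union> X"
      have K: "k < m" if "k \<in> ?K" for k using that insert unfolding large_def by auto
      have iK: "i \<notin> ?K" using False insert by auto
      have "finite ?K" using insert unfolding large_def by auto
      define R where "R = {s' k | k. k \<in> ?K \<and> t i < t k}"
      have finR: "finite R" unfolding R_def using \<open>finite ?K\<close> by auto
      define y where "y = (if R = {} then n else Min R)"
      have y: "s' k < y \<longleftrightarrow> t k < t i" if k: "k \<in> ?K" for k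
      proof (cases "t i < t k")
        case True
        then have "s' k \<in> R" unfolding R_def using k by blast
        then have "y \<le> s' k" unfolding y_def using finR by auto
        then show ?thesis using True by auto
      next
        case nk: False
        then have ti: "t k < t i" using fits_linear[OF t, of k i] K[OF k] im iK k by auto
        have "s' k < y"
        proof (cases "R = {}")
          case True
          then show ?thesis using f' l_pos[of k] K[OF k] unfolding fits_def y_def by fastforce
        next
          case False
          then have "y \<in> R" using finR unfolding y_def by simp
          then obtain r where "y = s' r" "r \<in> ?K" "t i < t r" unfolding R_def by blast
          then show ?thesis using o'[OF k, of r] ti by auto
        qed
        then show ?thesis using ti by simp
      qed
      obtain s2 where s2: "hop\<^sup>*\<^sup>* s' s2"
        "\<And>j k. j<m \<Longrightarrow> k<m \<Longrightarrow> j \<noteq> i \<Longrightarrow> k \<noteq> i \<Longrightarrow> s2 j < s2 k \<longleftrightarrow> s' j < s' k"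
        "\<And>j. j<m \<Longrightarrow> j \<noteq> i \<Longrightarrow> s2 j < s2 i \<longleftrightarrow> s' j < y"
        using hops_insert[OF f' im False, of y] by blast
      have f2: "fits s2" using hops_fits s2(1) f' by blast
      have "s2 j < s2 k \<longleftrightarrow> t j < t k" if jk: "j \<in> large \<union> insert i X" "k \<in> large \<union> insert i X" for j k
      proof -
        consider "j = k" | "j \<in> ?K" "k \<in> ?K" | "j \<in> ?K" "k = i" | "j = i" "k \<in> ?K" using jk by blast
        then show ?thesis
        proof cases
          case 2
          then have "j \<noteq> i" "k \<noteq> i" "j < m" "k < m" using iK K by auto
          then show ?thesis using s2(2) o' 2 by simp
        next
          case 3
          then have "j \<noteq> i" "j < m" using iK K by auto
          then show ?thesis using s2(3)[of j] y[of j] 3 by simp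
        next
          case 4
          then have ki: "k \<noteq> i" "k < m" using iK K by auto
          then have "s2 k < s2 i \<longleftrightarrow> t k < t i" using s2(3)[of k] y[of k] 4 by simp
          then show ?thesis using fits_linear[OF f2, of k i] fits_linear[OF t, of k i] ki im 4 by auto
        qed auto
      qed
      then show ?thesis using s' s2(1) by (meson rtranclp_trans)
    qed
  qed
  from this[of "{..<m}"] obtain s' where s': "hop\<^sup>*\<^sup>* s s'"
    and "\<And>i j. i < m \<Longrightarrow> j < m \<Longrightarrow> s' i < s' j \<longleftrightarrow> t i < t j" by auto
  then have "hop\<^sup>*\<^sup>* s' t" using hops_same_order hops_fits s t by blast
  with s' show ?thesis by (rule rtranclp_trans)
qed

text \<open>The free space is less than the length of a large piece, so a large piece never jumps over another.\<close>

lemma hop_large_order: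
  assumes s: "fits s" and "hop s t" and i: "i \<in> large" and j: "j \<in> large"
  shows "s i < s j \<longleftrightarrow> t i < t j"
proof -
  obtain k where k: "k < m" "\<And>j. j < m \<Longrightarrow> j \<noteq> k \<Longrightarrow> t j = s j" and t: "fits t"
    using assms(2) unfolding hop_def by blast
  have tot: "slack + sum l {..<m} = n" using fits_total_length[OF s] unfolding slack_def by auto
  have no: "False" if kl: "k \<in> large" and a: "a < m" "a \<noteq> k" and lt: "u k < u a" "v a < v k"
    and u: "fits u" and v: "fits v" and uv': "\<forall>j<m. j \<noteq> k \<longrightarrow> u j = v j" for u v a
  proof -
    have uv: "u j = v j" if "j < m" "j \<noteq> k" for j using uv' that by blast
    define b where "b = (\<lambda>j. if j = m then v k else u j)"
    define l' where "l' = (\<lambda>j. if j = m then l k else l j)"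
    have e1: "u k + l k \<le> v k"
      using fits_less[OF u k(1) a(1) lt(1)] fits_less[OF v a(1) k(1) lt(2)] uv[OF a] by simp
    have "sum l' {..<Suc m} \<le> n - 0"
    proof (rule sum_lengths_disjoint_intervals[where s = b])
      fix j assume "j \<in> {..<Suc m}"
      then show "0 \<le> b j \<and> b j + l' j \<le> n" using u v k(1) unfolding b_def l'_def fits_def by auto
    next
      fix i j assume ij: "i \<in> {..<Suc m}" "j \<in> {..<Suc m}" "i \<noteq> j"
      have *: "v k + l k \<le> u j \<or> u j + l j \<le> v k" if "j < m" for j
      proof (cases "j = k")
        case False
        then show ?thesis using v k(1) that uv[OF that False] unfolding fits_def apart_def by auto
      qed (use e1 in auto)
      show "b i + l' i \<le> b j \<or> b j + l' j \<le> b i"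
      proof (cases "i = m \<or> j = m")
        case True
        then show ?thesis using *[of i] *[of j] ij unfolding b_def l'_def by auto
      next
        case False
        then show ?thesis using u ij unfolding b_def l'_def fits_def apart_def by auto
      qed
    qed simp
    moreover have "sum l' {..<Suc m} = sum l {..<m} + l k" unfolding l'_def by simp
    ultimately show False using kl tot unfolding large_def by auto
  qed
  have ij: "i < m" "j < m" using i j unfolding large_def by auto
  have ts: "\<forall>j<m. j \<noteq> k \<longrightarrow> t j = s j" and st: "\<forall>j<m. j \<noteq> k \<longrightarrow> s j = t j"
    using k(2) by auto
  show ?thesis
  proof (cases "i = j")
    case ne: False
    consider "i \<noteq> k" "j \<noteq> k" | "i = k" | "j = k" by blast
    then show ?thesis
    proof cases
      case 1
      then show ?thesis using k ij by simp
    next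
      case 2
      have "\<not> (s i < s j \<and> t j < t i)" using no[of j s t, OF _ _ _ _ _ s t st] i 2 ij ne by auto
      moreover have "\<not> (t i < t j \<and> s j < s i)" using no[of j t s, OF _ _ _ _ _ t s ts] i 2 ij ne by auto
      ultimately show ?thesis using fits_linear[OF s ij ne] fits_linear[OF t ij ne] by auto
    next
      case 3
      have "\<not> (s j < s i \<and> t i < t j)" using no[of i s t, OF _ _ _ _ _ s t st] j 3 ij ne by auto
      moreover have "\<not> (t j < t i \<and> s i < s j)" using no[of i t s, OF _ _ _ _ _ t s ts] j 3 ij ne by auto
      ultimately show ?thesis using fits_linear[OF s ij ne] fits_linear[OF t ij ne] by auto
    qed
  qed simp
qed

lemma hops_large_order:
  "hop\<^sup>*\<^sup>* s t \<Longrightarrow> fits s \<Longrightarrow> i \<in> large \<Longrightarrow> j \<in> large \<Longrightarrow> s i < s j \<longleftrightarrow> t i < t j"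
proof (induction rule: rtranclp_induct)
  case (step t u)
  then show ?case using hop_large_order[of t u i j] hops_fits by blast
qed simp

definition large_before :: "(nat \<Rightarrow> nat) \<Rightarrow> nat \<Rightarrow> nat \<Rightarrow> nat set" where
  "large_before s p x = {i \<in> large. i \<noteq> p \<and> s i < x}"

definition small_others :: "nat \<Rightarrow> nat set" where
  "small_others p = {i. i < m \<and> i \<notin> large \<and> i \<noteq> p}"

text \<open>The number x tells between which large pieces p goes: those starting before x stay to its left.
  A set of small pieces of suitable total length goes to its left as well.\<close>

lemma reachable_start:
  assumes s: "fits s" and p: "p < m"
  shows "(\<exists>t. hop\<^sup>*\<^sup>* s t \<and> t p = y) \<longleftrightarrow>
    (\<exists>x\<le>n. (p \<in> large \<longrightarrow> x = s p) \<and> sum l (large_before s p x) \<le> y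
       \<and> y \<le> slack + sum l (large_before s p x) + sum l (small_others p) \<and> y + l p \<le> n)"
proof -
  have tot: "slack + sum l {..<m} = n" using fits_total_length[OF s] unfolding slack_def by auto
  let ?A = "\<lambda>x. {i \<in> large. i \<noteq> p \<and> \<not> s i < x}"
  have finL: "finite large" unfolding large_def by simp
  have split: "sum l {..<m} = l p + sum l (large_before s p x) + sum l (?A x) + sum l (small_others p)" for x
  proof -
    have lm: "i < m" if "i \<in> large" for i using that unfolding large_def by simp
    have fin: "finite (large_before s p x)" "finite (?A x)" "finite (small_others p)"
      using finL unfolding large_before_def small_others_def by auto
    have e: "{..<m} = insert p (large_before s p x \<union> ?A x \<union> small_others p)"
      unfolding large_before_def small_others_def using p lm by blast
    have "sum l {..<m} = l p + sum l (large_before s p x \<union> ?A x \<union> small_others p)"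
      unfolding e using fin by (intro sum.insert) (auto simp: large_before_def small_others_def)
    moreover have "sum l (large_before s p x \<union> ?A x \<union> small_others p)
        = sum l (large_before s p x \<union> ?A x) + sum l (small_others p)"
      using fin by (intro sum.union_disjoint) (auto simp: large_before_def small_others_def)
    moreover have "sum l (large_before s p x \<union> ?A x) = sum l (large_before s p x) + sum l (?A x)"
      using fin by (intro sum.union_disjoint) (auto simp: large_before_def)
    ultimately show ?thesis by simp
  qed
  show ?thesis
  proof
    assume "\<exists>t. hop\<^sup>*\<^sup>* s t \<and> t p = y"
    then obtain t where t: "hop\<^sup>*\<^sup>* s t" "t p = y" by blast
    have ft: "fits t" using hops_fits[OF t(1) s] .
    have ord: "i \<in> large \<Longrightarrow> j \<in> large \<Longrightarrow> s i < s j \<longleftrightarrow> t i < t j" for i j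
      using hops_large_order[OF t(1) s] .
    define R where "R = {s k | k. k \<in> large \<and> k \<noteq> p \<and> t p < t k}"
    have finR: "finite R" unfolding R_def using finL by auto
    have lm: "k \<in> large \<Longrightarrow> k < m" for k unfolding large_def by simp
    have sn: "k < m \<Longrightarrow> s k < n" for k using fits_end[OF s, of k] l_pos[of k] by simp
    define x where "x = (if p \<in> large then s p else if R = {} then n else Min R)"
    have x: "s k < x \<longleftrightarrow> t k < t p" if k: "k \<in> large" "k \<noteq> p" for k
    proof (cases "p \<in> large")
      case True
      then show ?thesis using ord[OF k(1) True] unfolding x_def by simp
    next
      case pl: False
      show ?thesis
      proof (cases "t p < t k")
        case True
        then have "s k \<in> R" unfolding R_def using k by blast
        then have "x \<le> s k" unfolding x_def using finR pl by auto
        then show ?thesis using True by auto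
      next
        case False
        then have ti: "t k < t p" using fits_linear[OF ft, of k p] lm k p by auto
        have "s k < x"
        proof (cases "R = {}")
          case True
          then show ?thesis using sn[of k] lm[OF k(1)] pl unfolding x_def by simp
        next
          case False
          then have "x \<in> R" using finR pl unfolding x_def by simp
          then obtain r where "x = s r" "r \<in> large" "t p < t r" unfolding R_def by blast
          then show ?thesis using ord[OF k(1), of r] ti by auto
        qed
        then show ?thesis using ti by simp
      qed
    qed
    have xn: "x \<le> n"
    proof -
      have "Min R \<le> n" if "R \<noteq> {}"
      proof -
        have "Min R \<in> R" using that finR by simp
        then obtain r where "Min R = s r" "r \<in> large" using R_def by blast
        then show ?thesis using sn[of r] lm by simp
      qed
      then show ?thesis unfolding x_def using sn[OF p] by auto
    qed
    have "sum l (large_before s p x) \<le> y - 0"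
    proof (rule sum_lengths_disjoint_intervals[where s = t])
      fix i assume "i \<in> large_before s p x"
      then show "0 \<le> t i \<and> t i + l i \<le> y"
        using x fits_less[OF ft, of i p] lm p t(2) unfolding large_before_def by auto
    next
      fix i j assume "i \<in> large_before s p x" "j \<in> large_before s p x" "i \<noteq> j"
      then show "t i + l i \<le> t j \<or> t j + l j \<le> t i"
        using fits_apart[OF ft, of i j] lm unfolding large_before_def apart_def by simp
    qed (simp add: large_before_def finL)
    moreover have "sum l (?A x) \<le> n - (y + l p)"
    proof (rule sum_lengths_disjoint_intervals[where s = t])
      fix i assume i: "i \<in> ?A x"
      then have "t p < t i" using x[of i] fits_linear[OF ft, of i p] lm p by auto
      then show "y + l p \<le> t i \<and> t i + l i \<le> n"
        using fits_less[OF ft, of p i] lm p t(2) i fits_end[OF ft, of i] by simp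
    next
      fix i j assume "i \<in> ?A x" "j \<in> ?A x" "i \<noteq> j"
      then show "t i + l i \<le> t j \<or> t j + l j \<le> t i"
        using fits_apart[OF ft, of i j] lm unfolding apart_def by simp
    qed (simp add: finL)
    moreover have "y + l p \<le> n" using fits_end[OF ft p] t(2) by simp
    moreover have "p \<in> large \<longrightarrow> x = s p" unfolding x_def by simp
    ultimately show "\<exists>x\<le>n. (p \<in> large \<longrightarrow> x = s p) \<and> sum l (large_before s p x) \<le> y
       \<and> y \<le> slack + sum l (large_before s p x) + sum l (small_others p) \<and> y + l p \<le> n"
      using xn split[of x] tot by (intro exI[of _ x]) auto
  next
    assume "\<exists>x\<le>n. (p \<in> large \<longrightarrow> x = s p) \<and> sum l (large_before s p x) \<le> y
       \<and> y \<le> slack + sum l (large_before s p x) + sum l (small_others p) \<and> y + l p \<le> n"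
    then obtain x where x: "p \<in> large \<longrightarrow> x = s p" "sum l (large_before s p x) \<le> y"
      "y \<le> slack + sum l (large_before s p x) + sum l (small_others p)" by blast
    have small: "l i \<le> slack" if "i \<in> small_others p" for i
      using that unfolding small_others_def large_def by auto
    have fins: "finite (small_others p)" unfolding small_others_def by simp
    moreover have "y \<le> sum l (large_before s p x) + sum l (small_others p) + slack" using x(3) by simp
    ultimately obtain B where B: "B \<subseteq> small_others p" "sum l (large_before s p x) + sum l B \<le> y"
      "y \<le> sum l (large_before s p x) + sum l B + slack"
      using greedy_subset_sum[of "small_others p" l slack "sum l (large_before s p x)" y] fins small x(2) by blast
    define C where "C = large_before s p x \<union> B"
    define D where "D = {..<m} - insert p C"
    have finB: "finite B" using B(1) fins finite_subset by blast
    have Cm: "C \<subseteq> {..<m} - {p}"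
      using B(1) unfolding C_def large_before_def small_others_def large_def by fastforce
    have finC: "finite C" and finD: "finite D" using Cm finite_subset unfolding D_def by auto
    have sumC: "sum l C = sum l (large_before s p x) + sum l B"
      unfolding C_def using B(1) finB finL
      by (intro sum.union_disjoint) (auto simp: large_before_def small_others_def)
    have sumD: "sum l {..<m} = l p + sum l C + sum l D"
    proof -
      have "{..<m} = insert p (C \<union> D)" using Cm p unfolding D_def by blast
      then have "sum l {..<m} = sum l (insert p (C \<union> D))" by simp
      also have "\<dots> = l p + sum l (C \<union> D)"
        using finC finD Cm by (intro sum.insert) (auto simp: D_def)
      also have "\<dots> = l p + (sum l C + sum l D)"
        using finC finD by (subst sum.union_disjoint) (auto simp: D_def)
      finally show ?thesis by simp
    qed
    define pk where "pk = (\<lambda>X z. \<Sum>k | k \<in> X \<and> s k < z. l k)"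
    have step: "pk X (s j) + l j \<le> pk X (s k)" if "finite X" "j \<in> X" "s j < s k" for X j k
    proof -
      have "pk X (s j) + l j = sum l (insert j {k \<in> X. s k < s j})"
        unfolding pk_def using that by (subst sum.insert) auto
      also have "\<dots> \<le> pk X (s k)" unfolding pk_def using that by (intro sum_mono2) auto
      finally show ?thesis .
    qed
    have top: "pk X (s j) + l j \<le> sum l X" if "finite X" "j \<in> X" for X j
    proof -
      have "pk X (s j) + l j = sum l (insert j {k \<in> X. s k < s j})"
        unfolding pk_def using that by (subst sum.insert) auto
      also have "\<dots> \<le> sum l X" using that by (intro sum_mono2) auto
      finally show ?thesis .
    qed
    have CD: "i \<notin> D" "i \<noteq> p" if "i \<in> C" for i using that Cm unfolding D_def by auto
    have Dp: "i \<noteq> p" "i \<notin> C" if "i \<in> D" for i using that unfolding D_def by auto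
    define t where "t = (\<lambda>i. if i = p then y else if i \<in> C then pk C (s i) else y + l p + pk D (s i))"
    have tp: "t p = y" unfolding t_def by simp
    have tC: "t i = pk C (s i)" "t i + l i \<le> y" if "i \<in> C" for i
      using that CD[OF that] top[OF finC that] sumC B(2) unfolding t_def by simp_all
    have tD: "t i = y + l p + pk D (s i)" "t i + l i \<le> n" if "i \<in> D" for i
      using Dp[OF that] top[OF finD that] sumD sumC tot B(3) unfolding t_def by simp_all
    have cases: "i = p \<or> i \<in> C \<or> i \<in> D" if "i < m" for i using that unfolding D_def by auto
    have ypn: "y + l p \<le> n" using sumD tot B(3) sumC by simp
    have ft: "fits t"
    proof (rule fitsI)
      fix i assume "i < m"
      then show "t i + l i \<le> n" using cases[of i] tp tC(2)[of i] tD(2)[of i] ypn by auto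
    next
      fix i j assume ij: "i < m" "j < m" "i \<noteq> j"
      have sij: "s i < s j \<or> s j < s i" using fits_linear[OF s] ij by blast
      show "apart t i j"
        using cases[OF ij(1)] cases[OF ij(2)]
      proof (elim disjE)
        assume "i \<in> C" "j \<in> C"
        then show ?thesis using sij step[OF finC, of i j] step[OF finC, of j i] tC unfolding apart_def by auto
      next
        assume "i \<in> D" "j \<in> D"
        then show ?thesis using sij step[OF finD, of i j] step[OF finD, of j i] tD unfolding apart_def by auto
      qed (use ij tp tC(2)[of i] tC(2)[of j] tD(1)[of i] tD(1)[of j] in \<open>auto simp: apart_def\<close>)
    qed
    have mono: "t i < t j" if ij: "i \<in> large" "j \<in> large" "s i < s j" for i j
    proof -
      have ijm: "i < m" "j < m" "i \<noteq> j" using ij unfolding large_def by auto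
      have inC: "k \<in> C \<longleftrightarrow> k \<noteq> p \<and> s k < x" if "k \<in> large" for k
        using that B(1) unfolding C_def large_before_def small_others_def by blast
      have lp: "0 < l i" "0 < l j" "0 < l p" using l_pos ijm p by auto
      show ?thesis
        using cases[OF ijm(1)] cases[OF ijm(2)]
      proof (elim disjE)
        assume "i \<in> C" "j \<in> C"
        then show ?thesis using step[OF finC, of i j] ij tC(1) lp by fastforce
      next
        assume "i \<in> D" "j \<in> D"
        then show ?thesis using step[OF finD, of i j] ij tD(1) lp by fastforce
      next
        assume "i = p" "j \<in> C"
        then show ?thesis using inC[of j] x(1) ij by auto
      next
        assume "i \<in> D" "j = p"
        then show ?thesis using inC[of i] x(1) ij unfolding D_def by auto
      next
        assume "i \<in> D" "j \<in> C"
        then show ?thesis using inC[of i] inC[of j] ij unfolding D_def by auto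
      qed (use ijm lp tp tC(2)[of i] tC(2)[of j] tD(1)[of i] tD(1)[of j] in auto)
    qed
    have "s i < s j \<longleftrightarrow> t i < t j" if "i \<in> large" "j \<in> large" for i j
      using mono[of i j] mono[of j i] that fits_linear[OF s, of i j] unfolding large_def
      by (cases "i = j") auto
    then have "hop\<^sup>*\<^sup>* s t" using hops_same_large_order[OF s ft] by blast
    then show "\<exists>t. hop\<^sup>*\<^sup>* s t \<and> t p = y" using tp by blast
  qed
qed

end

section \<open>Register programs and their Turing machines\<close>

text \<open>Registers hold positions in the input w, so values never exceed the length of w and
  incrementing saturates there.\<close>

datatype com = Zero nat | Inc nat | Seq com com | While nat nat com | IfBit nat com

inductive run :: "bool list \<Rightarrow> com \<Rightarrow> (nat \<Rightarrow> nat) \<Rightarrow> (nat \<Rightarrow> nat) \<Rightarrow> bool" for w where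
  Zero: "run w (Zero r) \<sigma> (\<sigma>(r := 0))"
| Inc: "run w (Inc r) \<sigma> (\<sigma>(r := min (length w) (Suc (\<sigma> r))))"
| Seq: "run w c \<sigma> \<sigma>' \<Longrightarrow> run w d \<sigma>' \<sigma>'' \<Longrightarrow> run w (Seq c d) \<sigma> \<sigma>''"
| WhileEq: "\<sigma> r = \<sigma> s \<Longrightarrow> run w (While r s c) \<sigma> \<sigma>"
| WhileNeq: "\<sigma> r \<noteq> \<sigma> s \<Longrightarrow> run w c \<sigma> \<sigma>' \<Longrightarrow> run w (While r s c) \<sigma>' \<sigma>'' \<Longrightarrow> run w (While r s c) \<sigma> \<sigma>''"
| IfSet: "\<sigma> r < length w \<Longrightarrow> w ! \<sigma> r \<Longrightarrow> run w c \<sigma> \<sigma>' \<Longrightarrow> run w (IfBit r c) \<sigma> \<sigma>'"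
| IfUnset: "\<not> (\<sigma> r < length w \<and> w ! \<sigma> r) \<Longrightarrow> run w (IfBit r c) \<sigma> \<sigma>"

fun uses_below :: "nat \<Rightarrow> com \<Rightarrow> bool" where
  "uses_below k (Zero r) = (r < k)"
| "uses_below k (Inc r) = (r < k)"
| "uses_below k (Seq c d) = (uses_below k c \<and> uses_below k d)"
| "uses_below k (While r s c) = (r < k \<and> s < k \<and> uses_below k c)"
| "uses_below k (IfBit r c) = (r < k \<and> uses_below k c)"

lemma uses_below_mono: "uses_below k c \<Longrightarrow> k \<le> k' \<Longrightarrow> uses_below k' c"
  by (induction c) auto

lemma ex_uses_below: "\<exists>k. uses_below k c"
proof (induction c)
  case (Seq c d)
  then obtain k k' where "uses_below k c" "uses_below k' d" by blast
  then have "uses_below (max k k') (Seq c d)" using uses_below_mono by auto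
  then show ?case by blast
next
  case (While r s c)
  then obtain k where "uses_below k c" by blast
  then have "uses_below (k + Suc r + Suc s) (While r s c)" using uses_below_mono[of k c] by auto
  then show ?case by blast
next
  case (IfBit r c)
  then obtain k where "uses_below k c" by blast
  then have "uses_below (k + Suc r) (IfBit r c)" using uses_below_mono[of k c] by auto
  then show ?case by blast
qed (use lessI in fastforce)+

text \<open>The simulating machine keeps a stack of commands in its state. A tape symbol is an input symbol
  together with the set of registers that point to its cell; the extra register number k marks
  cell 0, where the head is between two commands. In the phases Put and Drop the mark of one register
  is off the tape and remembered in the state.\<close>

datatype phase = Start | Home "com list" | Seek "com list" | Put nat "com list"
  | Drop nat "com list" | Back "com list" | Halt bool

fun target :: "com \<Rightarrow> nat" where
  "target (Zero r) = r"
| "target (Inc r) = r"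
| "target (Seq c d) = 0"
| "target (While r s c) = r"
| "target (IfBit r c) = r"

fun act :: "com \<Rightarrow> com list \<Rightarrow> nat \<Rightarrow> nat set \<Rightarrow> phase \<times> nat set \<times> int" where
  "act (Zero r) K b M = (Drop r K, M - {r}, 0)"
| "act (Inc r) K b M = (if b = 0 then (Back K, M, 0) else (Put r K, M - {r}, 1))"
| "act (Seq c d) K b M = (Back (c # d # K), M, 0)"
| "act (While r s c) K b M = (Back (if s \<in> M then K else c # While r s c # K), M, 0)"
| "act (IfBit r c) K b M = (Back (if b = 2 then c # K else K), M, 0)"

fun stacks :: "com \<Rightarrow> com list \<Rightarrow> com list set" where
  "stacks (Seq c d) K = insert (Seq c d # K) (stacks c (d # K) \<union> stacks d K)"
| "stacks (While r s c) K = insert (While r s c # K) (stacks c (While r s c # K))"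
| "stacks (IfBit r c) K = insert (IfBit r c # K) (stacks c K)"
| "stacks c K = {c # K}"

fun next_stacks :: "com list \<Rightarrow> com list set" where
  "next_stacks [] = {}"
| "next_stacks (Seq c d # K) = {c # d # K}"
| "next_stacks (While r s c # K) = {K, c # While r s c # K}"
| "next_stacks (IfBit r c # K) = {K, c # K}"
| "next_stacks (c # K) = {K}"

lemma finite_stacks: "finite (stacks c K)"
  by (induction c arbitrary: K) auto

lemma Cons_in_stacks: "c # K \<in> stacks c K"
  by (cases c) auto

lemma stacks_closed: "L \<in> stacks c K \<Longrightarrow> next_stacks L \<subseteq> insert K (stacks c K)"
proof (induction c arbitrary: K L)
  case (Seq c d)
  show ?case
  proof (cases "L = Seq c d # K")
    case False
    then consider "L \<in> stacks c (d # K)" | "L \<in> stacks d K" using Seq.prems by auto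
    then show ?thesis
      using Seq.IH(1)[of L "d # K"] Seq.IH(2)[of L K] Cons_in_stacks[of d K] by cases auto
  qed (use Cons_in_stacks in auto)
next
  case (While r s c)
  show ?case
  proof (cases "L = While r s c # K")
    case False
    then show ?thesis using While.IH[of L "While r s c # K"] While.prems by auto
  qed (use Cons_in_stacks in auto)
next
  case (IfBit r c)
  show ?case
  proof (cases "L = IfBit r c # K")
    case False
    then show ?thesis using IfBit.IH[of L K] IfBit.prems by auto
  qed (use Cons_in_stacks in auto)
qed auto

fun delta :: "com \<Rightarrow> nat \<Rightarrow> nat \<Rightarrow> phase \<Rightarrow> nat \<times> nat set \<Rightarrow> phase \<times> (nat \<times> nat set) \<times> int" where
  "delta c k out Start (b, M) = (Home [c], (b, {..k}), 0)"
| "delta c k out (Home []) (b, M) = (Halt (out \<notin> M), (b, M), 0)"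
| "delta c k out (Home (d # K)) (b, M) = (Seek (d # K), (b, M), 0)"
| "delta c k out (Seek []) (b, M) = (Back [], (b, M), 0)"
| "delta c k out (Seek (d # K)) (b, M) = (if target d \<in> M
     then (case act d K b M of (q, M', i) \<Rightarrow> (q, (b, M'), i)) else (Seek (d # K), (b, M), 1))"
| "delta c k out (Put r K) (b, M) = (Back K, (b, insert r M), 0)"
| "delta c k out (Drop r K) (b, M) = (if k \<in> M then (Home K, (b, insert r M), 0) else (Drop r K, (b, M), -1))"
| "delta c k out (Back K) (b, M) = (if k \<in> M then (Home K, (b, M), 0) else (Back K, (b, M), -1))"
| "delta c k out (Halt x) (b, M) = (Halt x, (b, M), 0)"

type_synonym config = "phase \<times> (int \<Rightarrow> nat \<times> nat set) \<times> int"

locale compiled =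
  fixes c0 :: com and k out :: nat
  assumes below: "uses_below k c0" and out: "out < k"
begin

definition step :: "config \<Rightarrow> config" where
  "step x = (case x of (q, tp, h) \<Rightarrow> case delta c0 k out q (tp h) of (q', s, i) \<Rightarrow> (q', tp(h := s), h + i))"

definition all_stacks :: "com list set" where
  "all_stacks = insert [] (stacks c0 [])"

definition phases :: "phase set" where
  "phases = {Start, Halt True, Halt False} \<union> Home ` all_stacks \<union> Seek ` all_stacks \<union> Back ` all_stacks
     \<union> (\<lambda>(r, K). Put r K) ` ({..k} \<times> all_stacks) \<union> (\<lambda>(r, K). Drop r K) ` ({..k} \<times> all_stacks)"

definition tape_symbols :: "(nat \<times> nat set) set" where
  "tape_symbols = {..2} \<times> Pow {..k}"

lemma finite_phases: "finite phases"
  unfolding phases_def all_stacks_def using finite_stacks by auto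

lemma finite_tape_symbols: "finite tape_symbols"
  unfolding tape_symbols_def by simp

lemma all_stacks_closed: "L \<in> all_stacks \<Longrightarrow> next_stacks L \<subseteq> all_stacks"
  unfolding all_stacks_def using stacks_closed[of L c0 "[]"] by auto

lemma act_closed:
  assumes "d # K \<in> all_stacks" "M \<subseteq> {..k}" "target d \<in> M" "act d K b M = (q, M', i)"
  shows "q \<in> phases \<and> M' \<subseteq> {..k} \<and> i \<in> {-1, 0, 1}"
  using assms all_stacks_closed[OF assms(1)]
  by (cases d) (auto simp: phases_def split: if_splits)

lemma delta_closed:
  assumes "q \<in> phases" "s \<in> tape_symbols" "delta c0 k out q s = (q', s', i)"
  shows "q' \<in> phases \<and> s' \<in> tape_symbols \<and> i \<in> {-1, 0, 1}"
proof -
  obtain b M where s: "s = (b, M)" by (cases s)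
  have bM: "b \<le> 2" "M \<subseteq> {..k}" using assms(2) s unfolding tape_symbols_def by auto
  consider "q = Start" | x where "q = Halt x" | "q = Home []"
    | d K where "q = Home (d # K)" "d # K \<in> all_stacks"
    | "q = Seek []" | d K where "q = Seek (d # K)" "d # K \<in> all_stacks"
    | r K where "q = Put r K" "r \<le> k" "K \<in> all_stacks"
    | r K where "q = Drop r K" "r \<le> k" "K \<in> all_stacks" | K where "q = Back K" "K \<in> all_stacks"
    using assms(1) unfolding phases_def by (cases q; auto; metis neq_Nil_conv)
  then show ?thesis
  proof cases
    case 6
    show ?thesis
    proof (cases "target (hd [d]) \<in> M")
      case True
      obtain M' where "act d K b M = (q', M', i)" "s' = (b, M')"
        using assms(3) 6 s True by (auto split: prod.splits)
      then show ?thesis using act_closed[OF 6(2) bM(2)] True bM unfolding tape_symbols_def by auto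
    next
      case False
      then show ?thesis using assms 6 s by auto
    qed
  next
    case 1
    then show ?thesis using assms s bM Cons_in_stacks[of c0 "[]"]
      unfolding tape_symbols_def phases_def all_stacks_def by auto
  next
    case 2
    then show ?thesis using assms s by auto
  next
    case 3
    then show ?thesis using assms s bM unfolding tape_symbols_def phases_def by auto
  next
    case 4
    then show ?thesis using assms s bM unfolding tape_symbols_def phases_def by auto
  next
    case 5
    then show ?thesis using assms s bM unfolding tape_symbols_def phases_def all_stacks_def by auto
  next
    case 7
    then show ?thesis using assms s bM unfolding tape_symbols_def phases_def by auto
  next
    case 8
    then show ?thesis using assms s bM unfolding tape_symbols_def phases_def by (auto split: if_splits)
  next
    case 9
    then show ?thesis using assms s bM unfolding tape_symbols_def phases_def by (auto split: if_splits)
  qed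
qed

fun carried :: "phase \<Rightarrow> nat set" where
  "carried (Put r K) = {r}"
| "carried (Drop r K) = {r}"
| "carried q = {}"

definition marks :: "phase \<Rightarrow> (nat \<Rightarrow> nat) \<Rightarrow> int \<Rightarrow> nat set" where
  "marks q \<sigma> i = (if q = Start then {} else
     {r. r < k \<and> r \<notin> carried q \<and> int (\<sigma> r) = i} \<union> (if i = 0 then {k} else {}))"

definition input_symbol :: "bool list \<Rightarrow> int \<Rightarrow> nat" where
  "input_symbol w i = (if 0 \<le> i \<and> i < int (length w) then (if w ! nat i then 2 else 1) else 0)"

definition conf :: "bool list \<Rightarrow> phase \<Rightarrow> (nat \<Rightarrow> nat) \<Rightarrow> nat \<Rightarrow> config" where
  "conf w q \<sigma> h = (q, (\<lambda>i. (input_symbol w i, marks q \<sigma> i)), int h)"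

definition bounded :: "bool list \<Rightarrow> (nat \<Rightarrow> nat) \<Rightarrow> bool" where
  "bounded w \<sigma> \<longleftrightarrow> (\<forall>r<k. \<sigma> r \<le> length w)"

definition configs :: "bool list \<Rightarrow> config set" where
  "configs w = {conf w q \<sigma> h | q \<sigma> h. q \<in> phases \<and> bounded w \<sigma> \<and> h \<le> length w}"

definition moves :: "bool list \<Rightarrow> config \<Rightarrow> config \<Rightarrow> bool" where
  "moves w = (\<lambda>x y. (\<exists>q \<sigma> h. x = conf w q \<sigma> h \<and> bounded w \<sigma> \<and> h \<le> length w) \<and> y = step x)\<^sup>*\<^sup>*"

lemma moves_trans: "moves w x y \<Longrightarrow> moves w y z \<Longrightarrow> moves w x z"
  unfolding moves_def by (rule rtranclp_trans)

lemma moves_step: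
  assumes "bounded w \<sigma>" "h \<le> length w"
    and "delta c0 k out q (input_symbol w (int h), marks q \<sigma> (int h)) = (q', (input_symbol w (int h), M), i)"
    and "int h' = int h + i" "marks q' \<sigma>' (int h) = M"
    and "\<And>j. j \<noteq> int h \<Longrightarrow> marks q' \<sigma>' j = marks q \<sigma> j"
  shows "moves w (conf w q \<sigma> h) (conf w q' \<sigma>' h')"
proof -
  have "step (conf w q \<sigma> h) = conf w q' \<sigma>' h'"
    unfolding step_def conf_def using assms(3-6) by (auto simp: fun_eq_iff)
  then show ?thesis unfolding moves_def using assms(1,2) by (intro r_into_rtranclp) metis
qed

lemma moves_seek:
  assumes "bounded w \<sigma>" "target d < k"
  shows "h \<le> \<sigma> (target d) \<Longrightarrow> moves w (conf w (Seek (d # K)) \<sigma> h) (conf w (Seek (d # K)) \<sigma> (\<sigma> (target d)))"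
proof (induction "\<sigma> (target d) - h" arbitrary: h)
  case 0
  then show ?case unfolding moves_def by simp
next
  case (Suc n)
  have b: "\<sigma> (target d) \<le> length w" using assms unfolding bounded_def by auto
  have "moves w (conf w (Seek (d # K)) \<sigma> h) (conf w (Seek (d # K)) \<sigma> (Suc h))"
  proof (rule moves_step[where i = 1 and M = "marks (Seek (d # K)) \<sigma> (int h)"])
    have "target d \<notin> marks (Seek (d # K)) \<sigma> (int h)"
      using Suc.hyps(2) assms(2) unfolding marks_def by auto
    then show "delta c0 k out (Seek (d # K)) (input_symbol w (int h), marks (Seek (d # K)) \<sigma> (int h)) =
      (Seek (d # K), (input_symbol w (int h), marks (Seek (d # K)) \<sigma> (int h)), 1)" by simp
  qed (use assms Suc b in auto)
  moreover have "n = \<sigma> (target d) - Suc h" "Suc h \<le> \<sigma> (target d)" using Suc.hyps(2) by auto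
  ultimately show ?case using moves_trans Suc.hyps(1) by blast
qed

lemma moves_back:
  assumes "bounded w \<sigma>"
  shows "h \<le> length w \<Longrightarrow> moves w (conf w (Back K) \<sigma> h) (conf w (Home K) \<sigma> 0)"
proof (induction h)
  case 0
  show ?case
    by (rule moves_step[where i = 0 and M = "marks (Back K) \<sigma> 0"]) (use assms in \<open>auto simp: marks_def\<close>)
next
  case (Suc h)
  have "moves w (conf w (Back K) \<sigma> (Suc h)) (conf w (Back K) \<sigma> h)"
    by (rule moves_step[where i = "-1" and M = "marks (Back K) \<sigma> (int (Suc h))"])
      (use assms Suc in \<open>auto simp: marks_def\<close>)
  then show ?case using moves_trans[OF _ Suc.IH] Suc.prems by simp
qed

lemma moves_drop:
  assumes "bounded w \<sigma>" "r < k"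
  shows "h \<le> length w \<Longrightarrow> moves w (conf w (Drop r K) \<sigma> h) (conf w (Home K) (\<sigma>(r := 0)) 0)"
proof (induction h)
  case 0
  show ?case
    by (rule moves_step[where i = 0 and M = "insert r (marks (Drop r K) \<sigma> 0)"])
      (use assms in \<open>auto simp: marks_def\<close>)
next
  case (Suc h)
  have "moves w (conf w (Drop r K) \<sigma> (Suc h)) (conf w (Drop r K) \<sigma> h)"
    by (rule moves_step[where i = "-1" and M = "marks (Drop r K) \<sigma> (int (Suc h))"])
      (use assms Suc in \<open>auto simp: marks_def\<close>)
  then show ?case using moves_trans[OF _ Suc.IH] Suc.prems by simp
qed

lemma moves_to_target:
  assumes "bounded w \<sigma>" "target d < k"
  shows "moves w (conf w (Home (d # K)) \<sigma> 0) (conf w (Seek (d # K)) \<sigma> (\<sigma> (target d)))"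
proof -
  have "moves w (conf w (Home (d # K)) \<sigma> 0) (conf w (Seek (d # K)) \<sigma> 0)"
    by (rule moves_step[where i = 0 and M = "marks (Home (d # K)) \<sigma> 0"])
      (use assms in \<open>auto simp: marks_def\<close>)
  then show ?thesis using moves_seek[OF assms, of 0] moves_trans by blast
qed

lemma uses_below_target: "uses_below k d \<Longrightarrow> target d < k"
  using out by (cases d) auto

lemma moves_to_next:
  assumes "bounded w \<sigma>" "uses_below k d"
    and "\<And>M. M = marks (Seek (d # K)) \<sigma> (int (\<sigma> (target d))) \<Longrightarrow>
      act d K (input_symbol w (int (\<sigma> (target d)))) M = (Back K', M, 0)"
  shows "moves w (conf w (Home (d # K)) \<sigma> 0) (conf w (Home K') \<sigma> 0)"
proof -
  let ?h = "\<sigma> (target d)"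
  have t: "target d < k" using uses_below_target assms(2) .
  have h: "?h \<le> length w" using assms(1) t unfolding bounded_def by auto
  have "moves w (conf w (Seek (d # K)) \<sigma> ?h) (conf w (Back K') \<sigma> ?h)"
    by (rule moves_step[where i = 0 and M = "marks (Seek (d # K)) \<sigma> (int ?h)"])
      (use assms t h in \<open>auto simp: marks_def\<close>)
  then show ?thesis using moves_to_target[OF assms(1) t] moves_back[OF assms(1) h] moves_trans by blast
qed

lemma run_bounded: "run w d \<sigma> \<sigma>' \<Longrightarrow> bounded w \<sigma> \<Longrightarrow> bounded w \<sigma>'"
  by (induction rule: run.induct) (auto simp: bounded_def)

lemma moves_run:
  "run w d \<sigma> \<sigma>' \<Longrightarrow> bounded w \<sigma> \<Longrightarrow> uses_below k d \<Longrightarrow>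
    moves w (conf w (Home (d # K)) \<sigma> 0) (conf w (Home K) \<sigma>' 0)"
proof (induction arbitrary: K rule: run.induct)
  case (Zero r \<sigma>)
  have r: "r < k" "\<sigma> r \<le> length w" using Zero unfolding bounded_def by auto
  have A: "moves w (conf w (Home (com.Zero r # K)) \<sigma> 0) (conf w (Seek (com.Zero r # K)) \<sigma> (\<sigma> r))"
    using moves_to_target[OF Zero(1), of "com.Zero r" K] r(1) by simp
  have B: "moves w (conf w (Seek (com.Zero r # K)) \<sigma> (\<sigma> r)) (conf w (Drop r K) \<sigma> (\<sigma> r))"
    by (rule moves_step[where i = 0 and M = "marks (Seek (com.Zero r # K)) \<sigma> (int (\<sigma> r)) - {r}"])
      (use Zero r in \<open>auto simp: marks_def\<close>)
  show ?case using moves_trans[OF moves_trans[OF A B] moves_drop[OF Zero(1) r]] .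
next
  case (Inc r \<sigma>)
  have r: "r < k" "\<sigma> r \<le> length w" using Inc unfolding bounded_def by auto
  show ?case
  proof (cases "\<sigma> r = length w")
    case True
    then have "\<sigma>(r := min (length w) (Suc (\<sigma> r))) = \<sigma>" by auto
    moreover have "moves w (conf w (Home (com.Inc r # K)) \<sigma> 0) (conf w (Home K) \<sigma> 0)"
      by (rule moves_to_next) (use Inc True in \<open>auto simp: input_symbol_def\<close>)
    ultimately show ?thesis by simp
  next
    case False
    let ?\<sigma> = "\<sigma>(r := Suc (\<sigma> r))"
    have e: "\<sigma>(r := min (length w) (Suc (\<sigma> r))) = ?\<sigma>" using False r by auto
    have b: "bounded w ?\<sigma>" using Inc(1) False r unfolding bounded_def by auto
    have A: "moves w (conf w (Home (com.Inc r # K)) \<sigma> 0) (conf w (Seek (com.Inc r # K)) \<sigma> (\<sigma> r))"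
      using moves_to_target[OF Inc(1), of "com.Inc r" K] r(1) by simp
    have B: "moves w (conf w (Seek (com.Inc r # K)) \<sigma> (\<sigma> r)) (conf w (Put r K) \<sigma> (Suc (\<sigma> r)))"
      by (rule moves_step[where i = 1 and M = "marks (Seek (com.Inc r # K)) \<sigma> (int (\<sigma> r)) - {r}"])
        (use Inc r False in \<open>auto simp: marks_def input_symbol_def\<close>)
    have C: "moves w (conf w (Put r K) \<sigma> (Suc (\<sigma> r))) (conf w (Back K) ?\<sigma> (Suc (\<sigma> r)))"
      by (rule moves_step[where i = 0 and M = "insert r (marks (Put r K) \<sigma> (int (Suc (\<sigma> r))))"])
        (use Inc r False in \<open>auto simp: marks_def\<close>)
    have h: "Suc (\<sigma> r) \<le> length w" using r False by auto
    show ?thesis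
      unfolding e using moves_trans[OF moves_trans[OF moves_trans[OF A B] C] moves_back[OF b h]] .
  qed
next
  case (Seq c \<sigma> \<sigma>' d \<sigma>'')
  have "moves w (conf w (Home (com.Seq c d # K)) \<sigma> 0) (conf w (Home (c # d # K)) \<sigma> 0)"
    by (rule moves_to_next) (use Seq in auto)
  moreover have "bounded w \<sigma>'" using run_bounded Seq by blast
  ultimately show ?case
    using moves_trans[OF moves_trans[OF _ Seq.IH(1)[of "d # K"]] Seq.IH(2)[of K]] Seq.prems by simp
next
  case (WhileEq \<sigma> r s c)
  show ?case
    by (rule moves_to_next) (use WhileEq in \<open>auto simp: marks_def\<close>)
next
  case (WhileNeq \<sigma> r s c \<sigma>' \<sigma>'')
  have "moves w (conf w (Home (While r s c # K)) \<sigma> 0) (conf w (Home (c # While r s c # K)) \<sigma> 0)"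
    by (rule moves_to_next) (use WhileNeq in \<open>auto simp: marks_def\<close>)
  moreover have "bounded w \<sigma>'" using run_bounded WhileNeq by blast
  ultimately show ?case
    using moves_trans[OF moves_trans[OF _ WhileNeq.IH(1)[of "While r s c # K"]] WhileNeq.IH(2)[of K]] WhileNeq.prems
    by simp
next
  case (IfSet \<sigma> r c \<sigma>')
  have "moves w (conf w (Home (IfBit r c # K)) \<sigma> 0) (conf w (Home (c # K)) \<sigma> 0)"
    by (rule moves_to_next) (use IfSet in \<open>auto simp: input_symbol_def\<close>)
  then show ?case using moves_trans[OF _ IfSet.IH[of K]] IfSet.prems by simp
next
  case (IfUnset \<sigma> r c)
  show ?case
    by (rule moves_to_next) (use IfUnset in \<open>auto simp: input_symbol_def\<close>)
qed

definition start :: "bool list \<Rightarrow> config" where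
  "start w = conf w Start (\<lambda>_. 0) 0"

lemma moves_all:
  assumes "run w c0 (\<lambda>_. 0) \<sigma>'"
  shows "moves w (start w) (conf w (Halt (\<sigma>' out \<noteq> 0)) \<sigma>' 0)"
proof -
  have b: "bounded w (\<lambda>_. 0)" unfolding bounded_def by simp
  have b': "bounded w \<sigma>'" using run_bounded[OF assms b] .
  have "moves w (start w) (conf w (Home [c0]) (\<lambda>_. 0) 0)"
    unfolding start_def
    by (rule moves_step[where i = 0 and M = "{..k}"]) (use b in \<open>auto simp: marks_def\<close>)
  moreover have "moves w (conf w (Home []) \<sigma>' 0) (conf w (Halt (\<sigma>' out \<noteq> 0)) \<sigma>' 0)"
    by (rule moves_step[where i = 0 and M = "marks (Home []) \<sigma>' 0"])
      (use b' out in \<open>auto simp: marks_def\<close>)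
  ultimately show ?thesis using moves_run[OF assms b below, of "[]"] moves_trans by metis
qed

lemma step_closed:
  assumes "fst x \<in> phases" "\<And>i. fst (snd x) i \<in> tape_symbols"
  shows "fst (step x) \<in> phases \<and> (\<forall>i. fst (snd (step x)) i \<in> tape_symbols)"
proof -
  obtain q tp h where x: "x = (q, tp, h)" by (cases x)
  obtain q' s i where d: "delta c0 k out q (tp h) = (q', s, i)" by (metis prod_cases3)
  show ?thesis using delta_closed[OF _ _ d] assms unfolding x step_def by (auto simp: d)
qed

lemma start_closed: "fst (start w) \<in> phases" "fst (snd (start w)) i \<in> tape_symbols"
  unfolding start_def conf_def phases_def tape_symbols_def marks_def input_symbol_def by auto

lemma steps_closed:
  "fst ((step ^^ t) (start w)) \<in> phases \<and> (\<forall>i. fst (snd ((step ^^ t) (start w))) i \<in> tape_symbols)"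
  by (induction t) (use start_closed step_closed in auto)

lemma moves_steps:
  assumes "moves w (start w) y"
  shows "\<exists>t. y = (step ^^ t) (start w) \<and> (\<forall>s<t. (step ^^ s) (start w) \<in> configs w)"
  using assms unfolding moves_def
proof (induction rule: rtranclp_induct)
  case base
  show ?case by (rule exI[of _ 0]) auto
next
  case (step y z)
  then obtain t where t: "y = (step ^^ t) (start w)" "\<forall>s<t. (step ^^ s) (start w) \<in> configs w" by blast
  obtain q \<sigma> h where y: "y = conf w q \<sigma> h" "bounded w \<sigma>" "h \<le> length w" and z: "z = compiled.step c0 k out y"
    using step(2) by metis
  have "q \<in> phases" using steps_closed[of t w] unfolding t(1)[symmetric] y conf_def by simp
  then have "y \<in> configs w" using y unfolding configs_def by blast
  moreover have "z = (compiled.step c0 k out ^^ Suc t) (start w)" unfolding z t(1) by simp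
  ultimately show ?case
    using t less_Suc_eq by (intro exI[of _ "Suc t"]) metis
qed

lemma card_configs:
  "finite (configs w) \<and> card (configs w) \<le> card phases * (length w + 1) ^ (k + 1)"
proof -
  let ?L = "{xs. set xs \<subseteq> {..length w} \<and> length xs = k}"
  let ?D = "phases \<times> ?L \<times> {..length w}"
  let ?f = "\<lambda>(q, xs, h). conf w q (\<lambda>r. xs ! r) h"
  have sub: "configs w \<subseteq> ?f ` ?D"
  proof
    fix x assume "x \<in> configs w"
    then obtain q \<sigma> h where x: "x = conf w q \<sigma> h" "q \<in> phases" "bounded w \<sigma>" "h \<le> length w"
      unfolding configs_def by blast
    have "(\<forall>r<k. map \<sigma> [0..<k] ! r = \<sigma> r)" by simp
    then have "marks q \<sigma> i = marks q (\<lambda>r. map \<sigma> [0..<k] ! r) i" for i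
      unfolding marks_def by (auto simp del: nth_map)
    then have "x = ?f (q, map \<sigma> [0..<k], h)" unfolding x(1) conf_def by (simp del: nth_map)
    moreover have "(q, map \<sigma> [0..<k], h) \<in> ?D" using x(2-4) unfolding bounded_def by auto
    ultimately show "x \<in> ?f ` ?D" by (rule image_eqI)
  qed
  have fin: "finite ?D" using finite_phases finite_lists_length_eq[of "{..length w}" k] by (intro finite_cartesian_product) auto
  have "card ?L = (length w + 1) ^ k" using card_lists_length_eq[of "{..length w}" k] by simp
  then have card: "card ?D = card phases * (length w + 1) ^ (k + 1)"
    unfolding card_cartesian_product by simp
  have "card (configs w) \<le> card ?D" by (rule surj_card_le[OF fin sub])
  then show ?thesis
    unfolding card using finite_subset[OF sub finite_imageI[OF fin]] by blast
qed

end

text \<open>A deterministic computation that halts does not visit a configuration twice.\<close>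

lemma halts_within_card:
  fixes f :: "'a \<Rightarrow> 'a"
  assumes fin: "finite C" and C: "\<And>t. t < T \<Longrightarrow> (f ^^ t) x \<in> C" and P: "P ((f ^^ T) x)"
  shows "\<exists>t\<le>card C. P ((f ^^ t) x)"
proof -
  define T0 where "T0 = (LEAST t. P ((f ^^ t) x))"
  have T0: "P ((f ^^ T0) x)" unfolding T0_def using P by (rule LeastI)
  have least: "T0 \<le> t" if "P ((f ^^ t) x)" for t unfolding T0_def using that by (rule Least_le)
  show ?thesis
  proof (cases "T0 \<le> card C")
    case False
    have "(\<lambda>t. (f ^^ t) x) ` {..card C} \<subseteq> C"
      using C least[OF P] False by auto
    then have "card ((\<lambda>t. (f ^^ t) x) ` {..card C}) \<le> card C" using fin card_mono by blast
    then have "\<not> inj_on (\<lambda>t. (f ^^ t) x) {..card C}" using card_image by fastforce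
    then obtain i j where ij: "i < j" "j \<le> card C" "(f ^^ i) x = (f ^^ j) x"
      unfolding inj_on_def by (metis atMost_iff linorder_neqE_nat)
    have "(f ^^ (T0 - j + i)) x = (f ^^ (T0 - j)) ((f ^^ i) x)" by (simp add: funpow_add)
    also have "\<dots> = (f ^^ (T0 - j + j)) x" unfolding ij(3) by (simp add: funpow_add)
    also have "T0 - j + j = T0" using False ij by simp
    finally have "T0 \<le> T0 - j + i" using least T0 by simp
    then show ?thesis using ij False by simp
  qed (use T0 in blast)
qed

lemma ex_numbering:
  assumes "finite A" "distinct xs" "set xs \<subseteq> A"
  shows "\<exists>f. bij_betw f A {..<card A} \<and> (\<forall>i<length xs. f (xs ! i) = i)"
proof -
  obtain ys where ys: "set ys = A - set xs" "distinct ys"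
    using finite_distinct_list[of "A - set xs"] assms(1) by auto
  let ?zs = "xs @ ys"
  have d: "distinct ?zs" "set ?zs = A" using ys assms by auto
  then have len: "length ?zs = card A" using distinct_card by metis
  have b: "bij_betw (nth ?zs) {..<card A} A" using bij_betw_nth[OF d(1)] d(2) len by simp
  let ?f = "the_inv_into {..<card A} (nth ?zs)"
  have "?f (xs ! i) = i" if "i < length xs" for i
  proof -
    have "?zs ! i = xs ! i" "i < card A" using that len by (auto simp: nth_append)
    then show ?thesis using the_inv_into_f_f[of "nth ?zs" "{..<card A}" i] b
      unfolding bij_betw_def by auto
  qed
  then show ?thesis using bij_betw_the_inv_into[OF b] by blast
qed

lemma (in compiled) ex_tm:
  "\<exists>M. tm_wf M \<and> (\<forall>w t b. fst ((step ^^ t) (start w)) = Halt b \<longrightarrow> tm_answers_within M w t b)"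
proof -
  have "{Start, Halt True, Halt False} \<subseteq> phases" unfolding phases_def by auto
  then obtain f where f: "bij_betw f phases {..<card phases}"
    "\<forall>i<3. f ([Start, Halt True, Halt False] ! i) = i"
    using ex_numbering[OF finite_phases, of "[Start, Halt True, Halt False]"] by auto
  have fq: "f Start = 0" "f (Halt True) = 1" "f (Halt False) = 2"
    using f(2)[rule_format, of 0] f(2)[rule_format, of 1] f(2)[rule_format, of 2] by (simp_all add: numeral_2_eq_2)
  have "{(0, {}), (1, {}), (2, {})} \<subseteq> tape_symbols" unfolding tape_symbols_def by auto
  then obtain g where g: "bij_betw g tape_symbols {..<card tape_symbols}"
    "\<forall>i<3. g ([(0, {}), (1, {}), (2, {})] ! i) = i"
    using ex_numbering[OF finite_tape_symbols, of "[(0, {}), (1, {}), (2, {})]"] by auto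
  have gs: "g (0, {}) = 0" "g (1, {}) = 1" "g (2, {}) = 2"
    using g(2)[rule_format, of 0] g(2)[rule_format, of 1] g(2)[rule_format, of 2] by (simp_all add: numeral_2_eq_2)
  define f' where "f' = inv_into phases f"
  define g' where "g' = inv_into tape_symbols g"
  have f': "f' (f q) = q" if "q \<in> phases" for q
    unfolding f'_def using inv_into_f_f[OF bij_betw_imp_inj_on[OF f(1)] that] .
  have g': "g' (g s) = s" if "s \<in> tape_symbols" for s
    unfolding g'_def using inv_into_f_f[OF bij_betw_imp_inj_on[OF g(1)] that] .
  have f'in: "f' q \<in> phases" if "q < card phases" for q
    unfolding f'_def using f(1) that inv_into_into[of q f phases] unfolding bij_betw_def by auto
  have g'in: "g' s \<in> tape_symbols" if "s < card tape_symbols" for s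
    unfolding g'_def using g(1) that inv_into_into[of s g tape_symbols] unfolding bij_betw_def by auto
  have flt: "f q < card phases" if "q \<in> phases" for q using f(1) that unfolding bij_betw_def by auto
  have glt: "g s < card tape_symbols" if "s \<in> tape_symbols" for s using g(1) that unfolding bij_betw_def by auto
  define M where "M = \<lparr>tm_states = card phases, tm_symbols = card tape_symbols,
    tm_delta = (\<lambda>q s. case delta c0 k out (f' q) (g' s) of (q', s', i) \<Rightarrow> (f q', g s', i))\<rparr>"
  have "tm_wf M"
    unfolding tm_wf_def
  proof (intro conjI allI impI)
    have "f (Halt False) < card phases" by (rule flt) (simp add: phases_def)
    then show "3 \<le> tm_states M" using fq by (simp add: M_def)
    have "g (2, {}) < card tape_symbols" by (rule glt) (simp add: tape_symbols_def)
    then show "3 \<le> tm_symbols M" using gs by (simp add: M_def)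
  next
    fix q s assume "q < tm_states M" "s < tm_symbols M"
    then have in': "f' q \<in> phases" "g' s \<in> tape_symbols" using f'in g'in by (auto simp: M_def)
    obtain q' s' i where d: "delta c0 k out (f' q) (g' s) = (q', s', i)" by (metis prod_cases3)
    show "case tm_delta M q s of (q', s', m) \<Rightarrow>
      q' < tm_states M \<and> s' < tm_symbols M \<and> m \<in> {- 1, 0, 1}"
      using delta_closed[OF in' d] flt[of q'] glt[of s'] by (simp add: M_def d)
  qed
  moreover have sim: "tm_run M w t = (case (step ^^ t) (start w) of (q, tp, h) \<Rightarrow> (f q, g \<circ> tp, h))" for w t
  proof (induction t)
    case 0
    show ?case unfolding tm_run_def tm_init_def start_def conf_def
      using fq gs by (auto simp: fun_eq_iff input_symbol_def marks_def)
  next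
    case (Suc t)
    obtain q tp h where x: "(step ^^ t) (start w) = (q, tp, h)" by (metis prod_cases3)
    have in': "q \<in> phases" "tp i \<in> tape_symbols" for i using steps_closed[of t w] x by auto
    obtain q' s' i where d: "delta c0 k out q (tp h) = (q', s', i)" by (metis prod_cases3)
    have r: "(step ^^ Suc t) (start w) = (q', tp(h := s'), h + i)" by (simp add: x step_def d)
    have l: "tm_run M w (Suc t) = tm_step M (f q, g \<circ> tp, h)" using Suc x unfolding tm_run_def by (simp add: comp_def)
    show ?case
    proof (cases "f q = 1 \<or> f q = 2")
      case True
      have "q = Halt True \<or> q = Halt False"
      proof -
        have "Halt True \<in> phases" "Halt False \<in> phases" unfolding phases_def by auto
        then show ?thesis using True f' in'(1) fq by metis
      qed
      then have "q' = q \<and> s' = tp h \<and> i = 0" using d by (cases "tp h") auto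
      then show ?thesis unfolding l r tm_step_def using True by (auto simp: fun_eq_iff)
    next
      case False
      then show ?thesis unfolding l r tm_step_def
        using f' g' in' d by (auto simp: M_def fun_eq_iff)
    qed
  qed
  have "tm_answers_within M w t b" if "fst ((step ^^ t) (start w)) = Halt b" for w t b
    using that fq unfolding tm_answers_within_def sim by (auto split: prod.splits)
  ultimately show ?thesis by blast
qed

lemma program_decided_in_polynomial_time:
  assumes "\<And>w. w \<noteq> [] \<Longrightarrow> \<exists>\<sigma>'. run w c0 (\<lambda>_. 0) \<sigma>' \<and> (\<sigma>' out \<noteq> 0 \<longleftrightarrow> D w)"
  shows "\<exists>M (c::nat) (k::nat). tm_wf M \<and> (\<forall>w. w \<noteq> [] \<longrightarrow> tm_answers_within M w (c * (length w + 1) ^ k) (D w))"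
proof -
  obtain k0 where "uses_below k0 c0" using ex_uses_below by blast
  then have "uses_below (k0 + Suc out) c0" using uses_below_mono by fastforce
  then interpret compiled c0 "k0 + Suc out" out by unfold_locales auto
  let ?k = "k0 + Suc out"
  obtain M where M: "tm_wf M" "\<And>w t b. fst ((step ^^ t) (start w)) = Halt b \<Longrightarrow> tm_answers_within M w t b"
    using ex_tm by blast
  have "tm_answers_within M w (card phases * (length w + 1) ^ (?k + 1)) (D w)" if w: "w \<noteq> []" for w
  proof -
    obtain \<sigma>' where s: "run w c0 (\<lambda>_. 0) \<sigma>'" "\<sigma>' out \<noteq> 0 \<longleftrightarrow> D w" using assms[OF w] by blast
    obtain T where T: "conf w (Halt (D w)) \<sigma>' 0 = (step ^^ T) (start w)"
      "\<forall>s<T. (step ^^ s) (start w) \<in> configs w"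
      using moves_steps[OF moves_all[OF s(1)]] unfolding s(2) by blast
    let ?P = "\<lambda>x. fst x = Halt (D w)"
    have "?P ((step ^^ T) (start w))" unfolding T(1)[symmetric] conf_def by simp
    then obtain t where t: "t \<le> card (configs w)" "?P ((step ^^ t) (start w))"
      using halts_within_card[of "configs w" T step "start w" ?P] T(2) card_configs by blast
    have keep: "?P (step x)" if "?P x" for x
    proof -
      obtain q tp h where x: "x = (q, tp, h)" by (metis prod_cases3)
      obtain b N where "tp h = (b, N)" by (cases "tp h")
      then show ?thesis using that unfolding x step_def by simp
    qed
    have later: "?P ((step ^^ (d + t)) (start w))" for d
    proof (induction d)
      case (Suc d)
      then show ?case using keep[of "(step ^^ (d + t)) (start w)"] by simp
    qed (use t(2) in simp)
    have "t \<le> card phases * (length w + 1) ^ (?k + 1)" using t(1) card_configs[of w] by linarith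
    then have "card phases * (length w + 1) ^ (?k + 1) - t + t = card phases * (length w + 1) ^ (?k + 1)"
      by (rule le_add_diff_inverse2)
    then show ?thesis using M(2)[OF later[of "card phases * (length w + 1) ^ (?k + 1) - t"]] by (simp only:)
  qed
  then show ?thesis using M(1) by blast
qed

section \<open>Functions computed by register programs\<close>

text \<open>An environment consists of the input and of the values of finitely many variables. Each loop
  or quantifier adds one variable.\<close>

class env =
  fixes input :: "'a \<Rightarrow> bool list" and regs :: "'a \<Rightarrow> nat list"

datatype word = Word (bits: "bool list")
datatype 'a ext = Ext (outer: 'a) (top: nat)

instantiation word :: env
begin
definition input_word :: "word \<Rightarrow> bool list" where "input_word e = bits e"
definition regs_word :: "word \<Rightarrow> nat list" where "regs_word e = []"
instance ..
end

instantiation ext :: (env) env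
begin
definition input_ext :: "'a ext \<Rightarrow> bool list" where "input_ext e = input (outer e)"
definition regs_ext :: "'a ext \<Rightarrow> nat list" where "regs_ext e = regs (outer e) @ [top e]"
instance ..
end

definition legal :: "'e::env \<Rightarrow> bool" where
  "legal e \<longleftrightarrow> input e \<noteq> [] \<and> (\<forall>x\<in>set (regs e). x \<le> length (input e))"

definition computes :: "com \<Rightarrow> nat list \<Rightarrow> nat \<Rightarrow> ('e::env \<Rightarrow> nat) \<Rightarrow> bool" where
  "computes c \<rho> m f \<longleftrightarrow> (\<forall>e \<sigma>. legal e \<longrightarrow> map \<sigma> \<rho> = regs e \<longrightarrow> (\<forall>i. \<sigma> i \<le> length (input e)) \<longrightarrow>
     (\<exists>\<sigma>'. run (input e) c \<sigma> \<sigma>' \<and> \<sigma>' m = f e \<and> (\<forall>i<m. \<sigma>' i = \<sigma> i)))"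

text \<open>The program may be asked to read the variables from any registers below m; it leaves these
  alone and returns the result in register m.\<close>

definition computable :: "('e::env \<Rightarrow> nat) \<Rightarrow> bool" where
  "computable f \<longleftrightarrow> (\<forall>\<rho> m. (\<forall>r\<in>set \<rho>. r < m) \<longrightarrow> (\<exists>c. computes c \<rho> m f))"

lemma run_le_length: "run w c \<sigma> \<sigma>' \<Longrightarrow> (\<And>i. \<sigma> i \<le> length w) \<Longrightarrow> \<sigma>' i \<le> length w"
  by (induction arbitrary: i rule: run.induct) auto

lemma computesE:
  assumes "computes c \<rho> m f" "legal e" "map \<sigma> \<rho> = regs e" "\<And>i. \<sigma> i \<le> length (input e)"
  obtains \<sigma>' where "run (input e) c \<sigma> \<sigma>'" "\<sigma>' m = f e" "\<And>i. i < m \<Longrightarrow> \<sigma>' i = \<sigma> i"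
    "\<And>i. \<sigma>' i \<le> length (input e)"
proof -
  obtain \<sigma>' where "run (input e) c \<sigma> \<sigma>'" "\<sigma>' m = f e" "\<forall>i<m. \<sigma>' i = \<sigma> i"
    using assms unfolding computes_def by blast
  moreover have "\<sigma>' i \<le> length (input e)" for i using run_le_length[OF calculation(1)] assms(4) .
  ultimately show thesis using that by blast
qed

lemma computesI:
  assumes "\<And>e \<sigma>. legal e \<Longrightarrow> map \<sigma> \<rho> = regs e \<Longrightarrow> (\<And>i. \<sigma> i \<le> length (input e)) \<Longrightarrow>
    \<exists>\<sigma>'. run (input e) c \<sigma> \<sigma>' \<and> \<sigma>' m = f e \<and> (\<forall>i<m. \<sigma>' i = \<sigma> i)"
  shows "computes c \<rho> m f"
  using assms unfolding computes_def by blast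

lemma computableE:
  assumes "computable f" "\<And>r. r \<in> set \<rho> \<Longrightarrow> r < m"
  obtains c where "computes c \<rho> m f"
  using assms unfolding computable_def by blast

lemma computableI:
  assumes "\<And>\<rho> m. (\<And>r. r \<in> set \<rho> \<Longrightarrow> r < m) \<Longrightarrow> \<exists>c. computes c \<rho> m f"
  shows "computable f"
  using assms unfolding computable_def by blast

lemma computable_le:
  assumes "computable f" "legal e"
  shows "f e \<le> length (input e)"
proof -
  let ?\<rho> = "[0..<length (regs e)]"
  let ?\<sigma> = "\<lambda>i. if i < length (regs e) then regs e ! i else 0"
  obtain c where c: "computes c ?\<rho> (length (regs e)) f"
    using computableE[OF assms(1), of ?\<rho> "length (regs e)"] by auto
  have "map ?\<sigma> ?\<rho> = regs e" by (rule nth_equalityI) auto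
  moreover have "?\<sigma> i \<le> length (input e)" for i using assms(2) unfolding legal_def by auto
  ultimately obtain \<sigma>' where "\<sigma>' (length (regs e)) = f e" "\<And>i. \<sigma>' i \<le> length (input e)"
    using computesE[OF c assms(2), of ?\<sigma>] by metis
  then show ?thesis by metis
qed

lemma computable_cong:
  assumes "computable f" "\<And>e. legal e \<Longrightarrow> f e = g e"
  shows "computable g"
proof -
  have "computes c \<rho> m f \<Longrightarrow> computes c \<rho> m g" for c \<rho> m
    using assms(2) unfolding computes_def by simp
  then show ?thesis using assms(1) unfolding computable_def by blast
qed

definition copy :: "nat \<Rightarrow> nat \<Rightarrow> com" where
  "copy m r = Seq (Zero m) (While r m (Inc m))"

lemma run_Inc': "\<sigma>' = \<sigma>(r := min (length w) (Suc (\<sigma> r))) \<Longrightarrow> run w (Inc r) \<sigma> \<sigma>'"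
  using run.Inc by simp

lemma run_copy:
  assumes "\<sigma> r \<le> length w" "r \<noteq> m"
  shows "run w (copy m r) \<sigma> (\<sigma>(m := \<sigma> r))"
proof -
  have "run w (While r m (Inc m)) (\<sigma>(m := x)) (\<sigma>(m := \<sigma> r))" if "x \<le> \<sigma> r" for x
    using that
  proof (induction "\<sigma> r - x" arbitrary: x)
    case 0
    then have "x = \<sigma> r" by simp
    show ?case unfolding \<open>x = \<sigma> r\<close> using assms(2) by (intro run.WhileEq) simp
  next
    case (Suc n)
    then have x: "n = \<sigma> r - Suc x" "Suc x \<le> \<sigma> r" by auto
    have "run w (Inc m) (\<sigma>(m := x)) (\<sigma>(m := Suc x))"
      using x assms by (intro run_Inc') auto
    then show ?case
      using run.WhileNeq[OF _ _ Suc.hyps(1)[OF x]] x assms(2) by simp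
  qed
  from this[of 0] show ?thesis
    unfolding copy_def using run.Seq[OF run.Zero] by blast
qed

lemma computable_zero: "computable (\<lambda>e. 0)"
proof (rule computableI)
  fix \<rho> :: "nat list" and m
  show "\<exists>c. computes c \<rho> m (\<lambda>e::'a. 0)"
    by (intro exI[of _ "Zero m"] computesI exI[of _ "(_ :: nat \<Rightarrow> nat)(m := 0)"]) (auto intro: run.Zero)
qed

lemma computable_top: "computable (top :: 'e::env ext \<Rightarrow> nat)"
proof (rule computableI)
  fix \<rho> :: "nat list" and m
  assume \<rho>: "\<And>r. r \<in> set \<rho> \<Longrightarrow> r < m"
  have "computes (copy m (last \<rho>)) \<rho> m (top :: 'e ext \<Rightarrow> nat)"
  proof (rule computesI)
    fix e :: "'e ext" and \<sigma>
    assume e: "map \<sigma> \<rho> = regs e" "\<And>i. \<sigma> i \<le> length (input e)"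
    then have "\<rho> \<noteq> []" unfolding regs_ext_def by auto
    then have l: "last \<rho> < m" "\<sigma> (last \<rho>) = top e"
      using \<rho> e(1) last_map[of \<rho> \<sigma>] unfolding regs_ext_def by auto
    have "run (input e) (copy m (last \<rho>)) \<sigma> (\<sigma>(m := \<sigma> (last \<rho>)))"
      by (rule run_copy) (use e(2) l(1) in auto)
    then show "\<exists>\<sigma>'. run (input e) (copy m (last \<rho>)) \<sigma> \<sigma>' \<and> \<sigma>' m = top e \<and> (\<forall>i<m. \<sigma>' i = \<sigma> i)"
      by (intro exI[of _ "\<sigma>(m := \<sigma> (last \<rho>))"] conjI) (use l in auto)
  qed
  then show "\<exists>c. computes c \<rho> m (top :: 'e ext \<Rightarrow> nat)" by blast
qed

lemma legal_outer: "legal e \<Longrightarrow> legal (outer e)"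
  unfolding legal_def input_ext_def regs_ext_def by auto

lemma computable_outer:
  fixes f :: "'e::env \<Rightarrow> nat"
  assumes "computable f"
  shows "computable (\<lambda>x. f (outer x))"
proof (rule computableI)
  fix \<rho> :: "nat list" and m
  assume \<rho>: "\<And>r. r \<in> set \<rho> \<Longrightarrow> r < m"
  obtain c where c: "computes c (butlast \<rho>) m f"
    using computableE[OF assms, of "butlast \<rho>" m] \<rho> in_set_butlastD by metis
  have "computes c \<rho> m (\<lambda>x. f (outer x))"
  proof (rule computesI)
    fix e :: "'e ext" and \<sigma>
    assume e: "legal e" "map \<sigma> \<rho> = regs e" "\<And>i. \<sigma> i \<le> length (input e)"
    have "map \<sigma> (butlast \<rho>) = regs (outer e)"
      using e(2) map_butlast[of \<sigma> \<rho>] unfolding regs_ext_def by simp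
    then show "\<exists>\<sigma>'. run (input e) c \<sigma> \<sigma>' \<and> \<sigma>' m = f (outer e) \<and> (\<forall>i<m. \<sigma>' i = \<sigma> i)"
      using computesE[OF c legal_outer[OF e(1)], of \<sigma>] e(3) unfolding input_ext_def by metis
  qed
  then show "\<exists>c. computes c \<rho> m (\<lambda>x. f (outer x))" by blast
qed

lemma computable_Suc:
  assumes "computable f"
  shows "computable (\<lambda>e. min (length (input e)) (Suc (f e)))"
proof (rule computableI)
  fix \<rho> :: "nat list" and m
  assume \<rho>: "\<And>r. r \<in> set \<rho> \<Longrightarrow> r < m"
  obtain c where c: "computes c \<rho> m f" using computableE[OF assms \<rho>] .
  have "computes (Seq c (Inc m)) \<rho> m (\<lambda>e. min (length (input e)) (Suc (f e)))"
  proof (rule computesI)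
    fix e :: 'a and \<sigma>
    assume e: "legal e" "map \<sigma> \<rho> = regs e" "\<And>i. \<sigma> i \<le> length (input e)"
    obtain \<sigma>' where s: "run (input e) c \<sigma> \<sigma>'" "\<sigma>' m = f e" "\<And>i. i < m \<Longrightarrow> \<sigma>' i = \<sigma> i"
      using computesE[OF c e] by metis
    have "run (input e) (Seq c (Inc m)) \<sigma> (\<sigma>'(m := min (length (input e)) (Suc (\<sigma>' m))))"
      by (rule run.Seq[OF s(1) run.Inc])
    then show "\<exists>\<sigma>'. run (input e) (Seq c (Inc m)) \<sigma> \<sigma>' \<and> \<sigma>' m = min (length (input e)) (Suc (f e))
        \<and> (\<forall>i<m. \<sigma>' i = \<sigma> i)"
      by (intro exI[of _ "\<sigma>'(m := min (length (input e)) (Suc (\<sigma>' m)))"] conjI) (use s(2,3) in auto)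
  qed
  then show "\<exists>c. computes c \<rho> m (\<lambda>e. min (length (input e)) (Suc (f e)))" by blast
qed

definition bit :: "bool list \<Rightarrow> nat \<Rightarrow> bool" where
  "bit w i \<longleftrightarrow> i < length w \<and> w ! i"

lemma computable_bit:
  assumes "computable f"
  shows "computable (\<lambda>e. of_bool (bit (input e) (f e)))"
proof (rule computableI)
  fix \<rho> :: "nat list" and m
  assume \<rho>: "\<And>r. r \<in> set \<rho> \<Longrightarrow> r < m"
  obtain c where c: "computes c \<rho> m f" using computableE[OF assms \<rho>] .
  let ?d = "Seq (Zero (Suc m)) (Seq (IfBit m (Inc (Suc m))) (copy m (Suc m)))"
  have "computes (Seq c ?d) \<rho> m (\<lambda>e. of_bool (bit (input e) (f e)))"
  proof (rule computesI)
    fix e :: 'a and \<sigma>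
    assume e: "legal e" "map \<sigma> \<rho> = regs e" "\<And>i. \<sigma> i \<le> length (input e)"
    let ?w = "input e"
    obtain \<sigma>1 where s1: "run ?w c \<sigma> \<sigma>1" "\<sigma>1 m = f e" "\<And>i. i < m \<Longrightarrow> \<sigma>1 i = \<sigma> i"
      using computesE[OF c e] by metis
    have N: "Suc 0 \<le> length ?w" using e(1) unfolding legal_def by (simp add: Suc_le_eq)
    let ?b = "of_bool (bit ?w (f e)) :: nat"
    let ?\<sigma>2 = "\<sigma>1(Suc m := 0)" and ?\<sigma>3 = "\<sigma>1(Suc m := ?b)"
    have "run ?w (IfBit m (Inc (Suc m))) ?\<sigma>2 ?\<sigma>3"
    proof (cases "bit ?w (f e)")
      case True
      then have "run ?w (Inc (Suc m)) ?\<sigma>2 ?\<sigma>3" using N by (intro run_Inc') (auto simp: fun_eq_iff min_absorb2)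
      then show ?thesis using True s1(2) by (intro run.IfSet) (auto simp: bit_def)
    next
      case False
      then have "?b = 0" by simp
      then show ?thesis using False s1(2) by (simp only:) (rule run.IfUnset, simp add: bit_def)
    qed
    moreover have "run ?w (copy m (Suc m)) ?\<sigma>3 (?\<sigma>3(m := ?b))"
      using run_copy[of ?\<sigma>3 "Suc m" ?w m] N by (simp add: bit_def)
    ultimately have "run ?w (Seq c ?d) \<sigma> (?\<sigma>3(m := ?b))"
      using s1(1) run.Zero run.Seq by metis
    then show "\<exists>\<sigma>'. run ?w (Seq c ?d) \<sigma> \<sigma>' \<and> \<sigma>' m = ?b \<and> (\<forall>i<m. \<sigma>' i = \<sigma> i)"
      using s1(3) by (intro exI[of _ "?\<sigma>3(m := ?b)"]) auto
  qed
  then show "\<exists>c. computes c \<rho> m (\<lambda>e. of_bool (bit (input e) (f e)))" by blast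
qed

lemma computable_length: "computable (\<lambda>e. length (input e))"
proof (rule computableI)
  fix \<rho> :: "nat list" and m
  let ?l = "While m (Suc m) (Seq (Inc m) (Inc (Suc m)))"
  have loop: "run w ?l (\<sigma>(m := x, Suc m := min (length w) (Suc x))) (\<sigma>(m := length w, Suc m := length w))"
    if "x \<le> length w" for w \<sigma> x
    using that
  proof (induction "length w - x" arbitrary: x)
    case 0
    then have "x = length w" by simp
    then have "min (length w) (Suc x) = length w" by simp
    then show ?case unfolding \<open>x = length w\<close> by (simp only:) (rule run.WhileEq, simp)
  next
    case (Suc n)
    then have x: "n = length w - Suc x" "Suc x \<le> length w" by auto
    let ?\<sigma> = "\<sigma>(m := x, Suc m := min (length w) (Suc x))"
    have "run w (Inc m) ?\<sigma> (\<sigma>(m := Suc x, Suc m := min (length w) (Suc x)))"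
      using x by (intro run_Inc') (auto simp: fun_eq_iff)
    moreover have "run w (Inc (Suc m)) (\<sigma>(m := Suc x, Suc m := min (length w) (Suc x)))
        (\<sigma>(m := Suc x, Suc m := min (length w) (Suc (Suc x))))"
      using x by (intro run_Inc') (auto simp: fun_eq_iff)
    ultimately show ?case
      using run.WhileNeq[OF _ run.Seq Suc.hyps(1)[OF x]] x by simp
  qed
  have "computes (Seq (Zero m) (Seq (Zero (Suc m)) (Seq (Inc (Suc m)) ?l))) \<rho> m (\<lambda>e::'a. length (input e))"
  proof (rule computesI)
    fix e :: 'a and \<sigma> :: "nat \<Rightarrow> nat"
    let ?w = "input e"
    have "run ?w (Inc (Suc m)) (\<sigma>(m := 0, Suc m := 0)) (\<sigma>(m := 0, Suc m := min (length ?w) (Suc 0)))"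
      by (intro run_Inc') (auto simp: fun_eq_iff)
    then have "run ?w (Seq (Zero m) (Seq (Zero (Suc m)) (Seq (Inc (Suc m)) ?l))) \<sigma>
        (\<sigma>(m := length ?w, Suc m := length ?w))"
      using loop[of 0 ?w \<sigma>] run.Zero run.Seq by (metis le0)
    then show "\<exists>\<sigma>'. run ?w (Seq (Zero m) (Seq (Zero (Suc m)) (Seq (Inc (Suc m)) ?l))) \<sigma> \<sigma>' \<and>
        \<sigma>' m = length ?w \<and> (\<forall>i<m. \<sigma>' i = \<sigma> i)"
      by (intro exI[of _ "\<sigma>(m := length ?w, Suc m := length ?w)"]) auto
  qed
  then show "\<exists>c. computes c \<rho> m (\<lambda>e::'a. length (input e))" by blast
qed

lemma computable_rec:
  fixes b n :: "'e::env \<Rightarrow> nat"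
  assumes "computable b" "computable n"
    and "computable (\<lambda>x. s (outer (outer x)) (top (outer x)) (top x))"
  shows "computable (\<lambda>e. rec_nat (b e) (s e) (n e))"
proof (rule computableI)
  fix \<rho> :: "nat list" and m
  assume \<rho>: "\<And>r. r \<in> set \<rho> \<Longrightarrow> r < m"
  obtain cb where cb: "computes cb \<rho> m b" using computableE[OF assms(1) \<rho>] .
  have "\<And>r. r \<in> set \<rho> \<Longrightarrow> r < Suc m" using \<rho> by fastforce
  then obtain cn where cn: "computes cn \<rho> (Suc m) n" using computableE[OF assms(2)] by blast
  have "\<And>r. r \<in> set (\<rho> @ [m + 2, m]) \<Longrightarrow> r < m + 3" using \<rho> by fastforce
  then obtain cs where cs: "computes cs (\<rho> @ [m + 2, m]) (m + 3) (\<lambda>x. s (outer (outer x)) (top (outer x)) (top x))"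
    using computableE[OF assms(3)] by blast
  let ?body = "Seq cs (Seq (copy m (m + 3)) (Inc (m + 2)))"
  let ?loop = "While (m + 2) (Suc m) ?body"
  let ?c = "Seq cb (Seq cn (Seq (Zero (m + 2)) ?loop))"
  have loop: "\<exists>\<sigma>'. run (input e) ?loop \<sigma> \<sigma>' \<and> \<sigma>' m = rec_nat (b e) (s e) (n e) \<and> (\<forall>i<m. \<sigma>' i = \<sigma> i)"
    if e: "legal e" and "map \<sigma> \<rho> = regs e" "\<And>i. \<sigma> i \<le> length (input e)"
      and "\<sigma> (Suc m) = n e" "\<sigma> (m + 2) = x" "x \<le> n e" "\<sigma> m = rec_nat (b e) (s e) x" for e \<sigma> x
    using that(2-)
  proof (induction "n e - x" arbitrary: x \<sigma>)
    case 0
    then have "x = n e" by simp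
    then show ?case using 0 run.WhileEq[of \<sigma> "m + 2" "Suc m" "input e" ?body] by auto
  next
    case (Suc k)
    let ?w = "input e"
    have x: "k = n e - Suc x" "Suc x \<le> n e" using Suc.hyps(2) by auto
    let ?e = "Ext (Ext e x) (rec_nat (b e) (s e) x)"
    have "map \<sigma> (\<rho> @ [m + 2, m]) = regs ?e" using Suc.prems unfolding regs_ext_def by simp
    moreover have "legal ?e"
      using e Suc.prems(2)[of "m + 2"] Suc.prems(2)[of m] Suc.prems(4,6)
      unfolding legal_def regs_ext_def input_ext_def by auto
    moreover have "\<sigma> i \<le> length (input ?e)" for i using Suc.prems(2) unfolding input_ext_def by simp
    ultimately obtain \<sigma>1 where s1: "run (input ?e) cs \<sigma> \<sigma>1" "\<sigma>1 (m + 3) = s e x (rec_nat (b e) (s e) x)"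
      "\<And>i. i < m + 3 \<Longrightarrow> \<sigma>1 i = \<sigma> i" "\<And>i. \<sigma>1 i \<le> length (input ?e)"
      using computesE[OF cs, of ?e \<sigma>] by auto
    have inp: "input ?e = ?w" unfolding input_ext_def by simp
    let ?\<sigma>2 = "\<sigma>1(m := \<sigma>1 (m + 3))"
    let ?\<sigma>3 = "?\<sigma>2(m + 2 := Suc x)"
    have "run ?w (copy m (m + 3)) \<sigma>1 ?\<sigma>2" using s1(4) unfolding inp by (intro run_copy) auto
    moreover have "n e \<le> length ?w" using Suc.prems(2)[of "Suc m"] Suc.prems(3) by simp
    then have "run ?w (Inc (m + 2)) ?\<sigma>2 ?\<sigma>3"
      using s1(3)[of "m + 2"] Suc.prems(4) x by (intro run_Inc') (auto simp: fun_eq_iff)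
    ultimately have body: "run ?w ?body \<sigma> ?\<sigma>3" using s1(1) run.Seq unfolding inp by metis
    have "\<exists>\<sigma>'. run ?w ?loop ?\<sigma>3 \<sigma>' \<and> \<sigma>' m = rec_nat (b e) (s e) (n e) \<and> (\<forall>i<m. \<sigma>' i = ?\<sigma>3 i)"
    proof (rule Suc.hyps(1)[OF x(1)])
      show "map ?\<sigma>3 \<rho> = regs e"
        using Suc.prems(1) s1(3) \<rho> by (fastforce simp flip: Suc.prems(1))
      show "?\<sigma>3 i \<le> length ?w" for i using run_le_length[OF body Suc.prems(2)] .
      show "?\<sigma>3 (Suc m) = n e" using s1(3)[of "Suc m"] Suc.prems(3) by simp
      show "?\<sigma>3 m = rec_nat (b e) (s e) (Suc x)" using s1(2) by simp
    qed (use x in auto)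
    then obtain \<sigma>' where \<sigma>': "run ?w ?loop ?\<sigma>3 \<sigma>'" "\<sigma>' m = rec_nat (b e) (s e) (n e)" "\<forall>i<m. \<sigma>' i = ?\<sigma>3 i"
      by blast
    have "\<sigma> (m + 2) \<noteq> \<sigma> (Suc m)" using Suc.prems x by auto
    then have "run ?w ?loop \<sigma> \<sigma>'" using run.WhileNeq[OF _ body \<sigma>'(1)] by blast
    moreover have "\<forall>i<m. \<sigma>' i = \<sigma> i" using \<sigma>'(3) s1(3) by auto
    ultimately show ?case using \<sigma>'(2) by blast
  qed
  have "computes ?c \<rho> m (\<lambda>e. rec_nat (b e) (s e) (n e))"
  proof (rule computesI)
    fix e :: 'e and \<sigma>
    assume e: "legal e" "map \<sigma> \<rho> = regs e" "\<And>i. \<sigma> i \<le> length (input e)"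
    let ?w = "input e"
    obtain \<sigma>1 where s1: "run ?w cb \<sigma> \<sigma>1" "\<sigma>1 m = b e" "\<And>i. i < m \<Longrightarrow> \<sigma>1 i = \<sigma> i"
      "\<And>i. \<sigma>1 i \<le> length ?w"
      using computesE[OF cb e] by metis
    have m1: "map \<sigma>1 \<rho> = regs e" using e(2) s1(3) \<rho> by (fastforce simp flip: e(2))
    obtain \<sigma>2 where s2: "run ?w cn \<sigma>1 \<sigma>2" "\<sigma>2 (Suc m) = n e" "\<And>i. i < Suc m \<Longrightarrow> \<sigma>2 i = \<sigma>1 i"
      "\<And>i. \<sigma>2 i \<le> length ?w"
      using computesE[OF cn e(1) m1 s1(4)] by metis
    let ?\<sigma>3 = "\<sigma>2(m + 2 := 0)"
    have "\<exists>\<sigma>'. run ?w ?loop ?\<sigma>3 \<sigma>' \<and> \<sigma>' m = rec_nat (b e) (s e) (n e) \<and> (\<forall>i<m. \<sigma>' i = ?\<sigma>3 i)"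
    proof (rule loop[OF e(1), where x = 0])
      show "map ?\<sigma>3 \<rho> = regs e" using m1 s2(3) \<rho> by (fastforce simp flip: m1)
    qed (use s1 s2 in auto)
    then obtain \<sigma>' where \<sigma>': "run ?w ?loop ?\<sigma>3 \<sigma>'" "\<sigma>' m = rec_nat (b e) (s e) (n e)" "\<forall>i<m. \<sigma>' i = ?\<sigma>3 i"
      by blast
    have "run ?w ?c \<sigma> \<sigma>'" using s1(1) s2(1) run.Zero \<sigma>'(1) run.Seq by metis
    moreover have "\<forall>i<m. \<sigma>' i = \<sigma> i" using \<sigma>'(3) s1(3) s2(3) by auto
    ultimately show "\<exists>\<sigma>'. run ?w ?c \<sigma> \<sigma>' \<and> \<sigma>' m = rec_nat (b e) (s e) (n e) \<and> (\<forall>i<m. \<sigma>' i = \<sigma> i)"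
      using \<sigma>'(2) by blast
  qed
  then show "\<exists>c. computes c \<rho> m (\<lambda>e. rec_nat (b e) (s e) (n e))" by blast
qed

lemma computable_one: "computable (\<lambda>e. 1)"
proof (rule computable_cong[OF computable_Suc[OF computable_zero]])
  fix e :: 'a assume "legal e"
  then have "Suc 0 \<le> length (input e)" unfolding legal_def by (simp add: Suc_le_eq)
  then show "min (length (input e)) (Suc 0) = 1" by (simp add: min_absorb2)
qed

definition decidable :: "('e::env \<Rightarrow> bool) \<Rightarrow> bool" where
  "decidable P \<longleftrightarrow> computable (\<lambda>e. of_bool (P e))"

lemma computable_if:
  assumes "decidable P" "computable f" "computable g"
  shows "computable (\<lambda>e. if P e then f e else g e)"
proof -
  have "computable (\<lambda>e. rec_nat (g e) (\<lambda>_ _. f e) (of_bool (P e)))"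
    using assms unfolding decidable_def by (intro computable_rec computable_outer)
  then show ?thesis by (rule computable_cong) auto
qed

lemma decidable_bit: "computable f \<Longrightarrow> decidable (\<lambda>e. bit (input e) (f e))"
  unfolding decidable_def by (rule computable_bit)

lemma decidable_not: "decidable P \<Longrightarrow> decidable (\<lambda>e. \<not> P e)"
  using computable_if[OF _ computable_zero computable_one, of P]
  unfolding decidable_def[of "\<lambda>e. \<not> P e"] by (rule computable_cong) auto

lemma decidable_conj: "decidable P \<Longrightarrow> decidable Q \<Longrightarrow> decidable (\<lambda>e. P e \<and> Q e)"
  unfolding decidable_def[of "\<lambda>e. P e \<and> Q e"]
  by (rule computable_cong[OF computable_if[OF _ _ computable_zero, of P "\<lambda>e. of_bool (Q e)"]])
    (auto simp: decidable_def)

lemma decidable_imp: "decidable P \<Longrightarrow> decidable Q \<Longrightarrow> decidable (\<lambda>e. P e \<longrightarrow> Q e)"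
  unfolding decidable_def[of "\<lambda>e. P e \<longrightarrow> Q e"]
  by (rule computable_cong[OF computable_if[OF _ _ computable_one, of P "\<lambda>e. of_bool (Q e)"]])
    (auto simp: decidable_def)

lemma computable_pred:
  assumes "computable f"
  shows "computable (\<lambda>e. f e - 1)"
proof -
  have "computable (\<lambda>e. rec_nat 0 (\<lambda>i _. i) (f e))"
    using assms by (intro computable_rec computable_outer computable_zero computable_top)
  moreover have "rec_nat 0 (\<lambda>i _. i) x = x - 1" for x :: nat by (cases x) auto
  ultimately show ?thesis by simp
qed

lemma computable_diff:
  assumes "computable f" "computable g"
  shows "computable (\<lambda>e. f e - g e)"
proof -
  have "computable (\<lambda>e. rec_nat (f e) (\<lambda>_ a. a - 1) (g e))"
    using assms by (intro computable_rec computable_pred computable_top)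
  moreover have "rec_nat x (\<lambda>_ a. a - 1) y = x - y" for x y :: nat by (induction y) auto
  ultimately show ?thesis by simp
qed

lemma decidable_le:
  assumes "computable f" "computable g"
  shows "decidable (\<lambda>e. f e \<le> g e)"
proof -
  have "computable (\<lambda>e. rec_nat 1 (\<lambda>_ _. 0) (f e - g e))"
    using assms by (intro computable_rec computable_diff computable_zero computable_one)
  then show ?thesis unfolding decidable_def
  proof (rule computable_cong)
    show "rec_nat 1 (\<lambda>_ _. 0) (f e - g e) = of_bool (f e \<le> g e)" for e
      by (cases "f e - g e") auto
  qed
qed

lemma decidable_less: "computable f \<Longrightarrow> computable g \<Longrightarrow> decidable (\<lambda>e. f e < g e)"
  using decidable_not[OF decidable_le, of g f] by (simp add: not_le)

lemma decidable_eq: "computable f \<Longrightarrow> computable g \<Longrightarrow> decidable (\<lambda>e. f e = g e)"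
  using decidable_conj[OF decidable_le decidable_le, of f g g f] by (simp add: order_eq_iff)

lemma computable_add:
  assumes "computable f" "computable g"
  shows "computable (\<lambda>e. min (length (input e)) (f e + g e))"
proof -
  have "computable (\<lambda>e. rec_nat (f e) (\<lambda>_ a. min (length (input e)) (Suc a)) (g e))"
  proof (intro computable_rec assms)
    have "computable (\<lambda>x::'a ext ext. min (length (input x)) (Suc (top x)))"
      by (intro computable_Suc computable_top)
    then show "computable (\<lambda>x::'a ext ext. min (length (input (outer (outer x)))) (Suc (top x)))"
      unfolding input_ext_def .
  qed
  moreover have "rec_nat x (\<lambda>_ a. min N (Suc a)) y = min N (x + y)" if "x \<le> N" for x y N :: nat
    using that by (induction y) auto
  ultimately show ?thesis
    using computable_le[OF assms(1)] by (auto intro: computable_cong)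
qed

lemma decidable_ex:
  assumes "computable n" "decidable (\<lambda>x. P (outer x) (top x))"
  shows "decidable (\<lambda>e. \<exists>k<n e. P e k)"
proof -
  have "computable (\<lambda>x. if P (outer (outer x)) (top (outer x)) then 1 else top x)"
  proof (intro computable_if computable_one computable_top)
    show "decidable (\<lambda>x. P (outer (outer x)) (top (outer x)))"
      using assms(2) unfolding decidable_def by (rule computable_outer)
  qed
  then have "computable (\<lambda>e. rec_nat 0 (\<lambda>k a. if P e k then 1 else a) (n e))"
    using assms(1) by (intro computable_rec computable_zero)
  moreover have "rec_nat 0 (\<lambda>k a. if P e k then 1 else a) m = (of_bool (\<exists>k<m. P e k) :: nat)" for e m
    by (induction m) (auto simp: less_Suc_eq)
  ultimately show ?thesis unfolding decidable_def by (rule computable_cong)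
qed

lemma decidable_all:
  assumes "computable n" "decidable (\<lambda>x. P (outer x) (top x))"
  shows "decidable (\<lambda>e. \<forall>k<n e. P e k)"
  using decidable_not[OF decidable_ex[OF assms(1) decidable_not[OF assms(2)]]] by simp

definition csum :: "bool list \<Rightarrow> nat \<Rightarrow> (nat \<Rightarrow> nat) \<Rightarrow> nat" where
  "csum w n f = min (length w) (\<Sum>k<n. f k)"

lemma computable_csum:
  assumes "computable n" "computable (\<lambda>x. f (outer x) (top x))"
  shows "computable (\<lambda>e. csum (input e) (n e) (f e))"
proof -
  have "computable (\<lambda>x. min (length (input x)) (top x + f (outer (outer x)) (top (outer x))))"
    using computable_outer[OF assms(2)] by (intro computable_add computable_top)
  then have "computable (\<lambda>x. min (length (input (outer (outer x)))) (top x + f (outer (outer x)) (top (outer x))))"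
    unfolding input_ext_def .
  then have "computable (\<lambda>e. rec_nat 0 (\<lambda>k a. min (length (input e)) (a + f e k)) (n e))"
    using assms(1) by (intro computable_rec computable_zero)
  moreover have "rec_nat 0 (\<lambda>k a. min N (a + g k)) m = min N (\<Sum>k<m. g k)" for N m :: nat and g
    by (induction m) (auto simp: min_def)
  ultimately show ?thesis unfolding csum_def by (rule computable_cong)
qed

lemma computable_program:
  assumes "decidable (\<lambda>e. P (bits e))"
  shows "\<exists>c. \<forall>w. w \<noteq> [] \<longrightarrow> (\<exists>\<sigma>'. run w c (\<lambda>_. 0) \<sigma>' \<and> (\<sigma>' 0 \<noteq> 0 \<longleftrightarrow> P w))"
proof -
  obtain c where c: "computes c [] 0 (\<lambda>e. of_bool (P (bits e)))"
    using computableE[OF assms[unfolded decidable_def], of "[]" 0] by auto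
  have "\<exists>\<sigma>'. run w c (\<lambda>_. 0) \<sigma>' \<and> (\<sigma>' 0 \<noteq> 0 \<longleftrightarrow> P w)" if "w \<noteq> []" for w
  proof -
    have "legal (Word w)" using that unfolding legal_def input_word_def regs_word_def by simp
    then obtain \<sigma>' where "run (input (Word w)) c (\<lambda>_. 0) \<sigma>'" "\<sigma>' 0 = of_bool (P (bits (Word w)))"
      using computesE[OF c, of "Word w" "\<lambda>_. 0"] unfolding regs_word_def by auto
    then show ?thesis unfolding input_word_def by auto
  qed
  then show ?thesis by blast
qed

section \<open>The decision procedure on encoded instances\<close>

lemma decidable_iff: "decidable P \<Longrightarrow> decidable Q \<Longrightarrow> decidable (\<lambda>e. P e \<longleftrightarrow> Q e)"
  unfolding decidable_def[of "\<lambda>e. P e \<longleftrightarrow> Q e"]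
  by (rule computable_cong[OF computable_if[of P "\<lambda>e. of_bool (Q e)" "\<lambda>e. of_bool (\<not> Q e)"]])
    (auto simp: decidable_def dest: decidable_not[unfolded decidable_def])

lemma input_outer: "input (outer x) = input x"
  unfolding input_ext_def by simp

text \<open>Every function below depends on the environment only through the input and through its
  arguments, so a program for it in the environment with one variable works everywhere.\<close>

definition computable1 :: "(bool list \<Rightarrow> nat \<Rightarrow> nat) \<Rightarrow> bool" where
  "computable1 F \<longleftrightarrow> computable (\<lambda>x::word ext. F (input x) (top x))"

lemma computable_apply:
  fixes h :: "'e::env \<Rightarrow> nat"
  assumes "computable1 F" "computable h"
  shows "computable (\<lambda>e. F (input e) (h e))"
proof (rule computableI)
  fix \<rho> :: "nat list" and m
  assume \<rho>: "\<And>r. r \<in> set \<rho> \<Longrightarrow> r < m"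
  obtain c where c: "computes c \<rho> m h" using computableE[OF assms(2) \<rho>] .
  obtain d where d: "computes d [m] (Suc m) (\<lambda>x::word ext. F (input x) (top x))"
    using computableE[OF assms(1)[unfolded computable1_def], of "[m]" "Suc m"] by auto
  have "computes (Seq c (Seq d (copy m (Suc m)))) \<rho> m (\<lambda>e. F (input e) (h e))"
  proof (rule computesI)
    fix e :: 'e and \<sigma>
    assume e: "legal e" "map \<sigma> \<rho> = regs e" "\<And>i. \<sigma> i \<le> length (input e)"
    let ?w = "input e"
    let ?x = "Ext (Word ?w) (h e)"
    obtain \<sigma>1 where s1: "run ?w c \<sigma> \<sigma>1" "\<sigma>1 m = h e" "\<And>i. i < m \<Longrightarrow> \<sigma>1 i = \<sigma> i"
      "\<And>i. \<sigma>1 i \<le> length ?w"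
      using computesE[OF c e] by metis
    have x: "input ?x = ?w" "regs ?x = [h e]"
      unfolding input_ext_def input_word_def regs_ext_def regs_word_def by auto
    have "legal ?x" using e(1) s1(2) s1(4)[of m] x unfolding legal_def by simp
    then obtain \<sigma>2 where s2: "run ?w d \<sigma>1 \<sigma>2" "\<sigma>2 (Suc m) = F ?w (h e)"
      "\<And>i. i < Suc m \<Longrightarrow> \<sigma>2 i = \<sigma>1 i" "\<And>i. \<sigma>2 i \<le> length ?w"
      using computesE[OF d, of ?x \<sigma>1] s1(2,4) x by auto
    have "run ?w (copy m (Suc m)) \<sigma>2 (\<sigma>2(m := \<sigma>2 (Suc m)))"
      by (rule run_copy) (use s2(4) in auto)
    then have "run ?w (Seq c (Seq d (copy m (Suc m)))) \<sigma> (\<sigma>2(m := \<sigma>2 (Suc m)))"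
      using s1(1) s2(1) run.Seq by metis
    then show "\<exists>\<sigma>'. run ?w (Seq c (Seq d (copy m (Suc m)))) \<sigma> \<sigma>' \<and> \<sigma>' m = F ?w (h e) \<and> (\<forall>i<m. \<sigma>' i = \<sigma> i)"
      by (intro exI[of _ "\<sigma>2(m := \<sigma>2 (Suc m))"] conjI) (use s1(3) s2(2,3) in auto)
  qed
  then show "\<exists>c. computes c \<rho> m (\<lambda>e. F (input e) (h e))" by blast
qed

named_theorems comp

definition sc :: "bool list \<Rightarrow> nat \<Rightarrow> nat" where "sc w x = min (length w) (Suc x)"
definition pl :: "bool list \<Rightarrow> nat \<Rightarrow> nat \<Rightarrow> nat" where "pl w x y = min (length w) (x + y)"

definition walk :: "(bool list \<Rightarrow> nat \<Rightarrow> nat) \<Rightarrow> bool list \<Rightarrow> nat \<Rightarrow> nat \<Rightarrow> nat" where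
  "walk F w a j = rec_nat a (\<lambda>_ x. if bit w x then F w (sc w x) else x) j"
definition skip :: "(bool list \<Rightarrow> nat \<Rightarrow> nat) \<Rightarrow> bool list \<Rightarrow> nat \<Rightarrow> nat" where
  "skip F w a = sc w (walk F w a (length w))"
definition item :: "(bool list \<Rightarrow> nat \<Rightarrow> nat) \<Rightarrow> bool list \<Rightarrow> nat \<Rightarrow> nat \<Rightarrow> nat" where
  "item F w a j = sc w (walk F w a j)"
definition count :: "(bool list \<Rightarrow> nat \<Rightarrow> nat) \<Rightarrow> bool list \<Rightarrow> nat \<Rightarrow> nat" where
  "count F w a = csum w (length w) (\<lambda>j. of_bool (bit w (walk F w a j)))"

definition skip_nat :: "bool list \<Rightarrow> nat \<Rightarrow> nat" where "skip_nat = skip sc"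
definition skip_int :: "bool list \<Rightarrow> nat \<Rightarrow> nat" where "skip_int w a = skip_nat w (sc w a)"
definition skip_cell :: "bool list \<Rightarrow> nat \<Rightarrow> nat" where "skip_cell w a = skip_int w (skip_int w a)"
definition skip_cells :: "bool list \<Rightarrow> nat \<Rightarrow> nat" where "skip_cells = skip skip_cell"

definition same :: "bool list \<Rightarrow> nat \<Rightarrow> nat \<Rightarrow> bool" where
  "same w i j \<longleftrightarrow> (\<forall>k<length w. pl w i k < skip_cell w i \<longrightarrow> (bit w (pl w i k) \<longleftrightarrow> bit w (pl w j k)))"

text \<open>Horner's scheme from the most significant bit, which is encoded last.\<close>

definition nat_at :: "bool list \<Rightarrow> nat \<Rightarrow> nat" where
  "nat_at w a = rec_nat 0 (\<lambda>t v. pl w (pl w v v) (of_bool (bit w (item sc w a (count sc w a - t - 1)))))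
     (count sc w a)"

definition frame_length :: "bool list \<Rightarrow> nat" where "frame_length w = count skip_cell w 0"
definition pieces_at :: "bool list \<Rightarrow> nat" where "pieces_at w = skip_cells w 0"
definition piece_count :: "bool list \<Rightarrow> nat" where "piece_count w = count skip_cells w (pieces_at w)"
definition piece :: "bool list \<Rightarrow> nat \<Rightarrow> nat" where "piece w i = item skip_cells w (pieces_at w) i"
definition index_at :: "bool list \<Rightarrow> nat" where "index_at w = skip skip_cells w (pieces_at w)"
definition index :: "bool list \<Rightarrow> nat" where "index w = nat_at w (index_at w)"
definition goal_at :: "bool list \<Rightarrow> nat" where "goal_at w = skip_nat w (index_at w)"
definition size_at :: "bool list \<Rightarrow> nat \<Rightarrow> nat" where "size_at w a = count skip_cell w a"
definition offset :: "bool list \<Rightarrow> nat \<Rightarrow> nat" where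
  "offset w a = csum w (frame_length w)
     (\<lambda>j. if same w (item skip_cell w 0 j) (item skip_cell w a 0) then j else 0)"
definition goal_inside :: "bool list \<Rightarrow> bool" where
  "goal_inside w \<longleftrightarrow> (\<forall>k<size_at w (goal_at w). \<exists>j<frame_length w.
     same w (item skip_cell w 0 j) (item skip_cell w (goal_at w) k))"
definition free :: "bool list \<Rightarrow> nat" where
  "free w = frame_length w - csum w (piece_count w) (\<lambda>i. size_at w (piece w i))"
definition large_left :: "bool list \<Rightarrow> nat \<Rightarrow> nat" where
  "large_left w x = csum w (piece_count w) (\<lambda>i. if i \<noteq> index w \<and> free w < size_at w (piece w i)
     \<and> offset w (piece w i) < x then size_at w (piece w i) else 0)"
definition small_total :: "bool list \<Rightarrow> nat" where
  "small_total w = csum w (piece_count w) (\<lambda>i. if i \<noteq> index w \<and> \<not> free w < size_at w (piece w i)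
     then size_at w (piece w i) else 0)"
definition accepts :: "bool list \<Rightarrow> bool" where
  "accepts w \<longleftrightarrow> goal_inside w \<and> (\<exists>x<sc w (frame_length w).
     (free w < size_at w (piece w (index w)) \<longrightarrow> x = offset w (piece w (index w))) \<and>
     large_left w x \<le> offset w (goal_at w) \<and>
     offset w (goal_at w) \<le> pl w (pl w (free w) (large_left w x)) (small_total w))"

lemmas [comp] = computable_zero computable_top computable_outer[OF computable_top]
  computable_length computable_if computable_pred computable_diff computable_csum
  decidable_bit decidable_not decidable_conj decidable_imp decidable_iff decidable_le
  decidable_less decidable_eq decidable_ex decidable_all

lemma computable_sc [comp]: "computable f \<Longrightarrow> computable (\<lambda>e. sc (input e) (f e))"
  unfolding sc_def by (rule computable_Suc)

lemma computable_pl [comp]: "computable f \<Longrightarrow> computable g \<Longrightarrow> computable (\<lambda>e. pl (input e) (f e) (g e))"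
  unfolding pl_def by (rule computable_add)

lemma computable_of_bool [comp]: "decidable P \<Longrightarrow> computable (\<lambda>e. of_bool (P e))"
  unfolding decidable_def .

lemma computable_walk [comp]:
  assumes "computable1 F" "computable a" "computable j"
  shows "computable (\<lambda>e. walk F (input e) (a e) (j e))"
proof -
  have "computable (\<lambda>x. if bit (input x) (top x) then F (input x) (sc (input x) (top x)) else top x)"
    by (intro comp computable_apply[OF assms(1)])
  then show ?thesis
    unfolding walk_def by (intro computable_rec assms) (simp only: input_outer)
qed

lemma computable_skip [comp]:
  "computable1 F \<Longrightarrow> computable a \<Longrightarrow> computable (\<lambda>e. skip F (input e) (a e))"
  unfolding skip_def by (intro comp)

lemma computable_item [comp]:
  "computable1 F \<Longrightarrow> computable a \<Longrightarrow> computable j \<Longrightarrow> computable (\<lambda>e. item F (input e) (a e) (j e))"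
  unfolding item_def by (intro comp)

lemma computable_count [comp]:
  assumes "computable1 F" "computable a"
  shows "computable (\<lambda>e. count F (input e) (a e))"
  unfolding count_def
  by (intro comp assms computable_outer[OF assms(2)]; (simp only: input_outer)?)+

lemma computable1_sc [comp]: "computable1 sc"
  unfolding computable1_def by (intro comp)

lemma computable_skip_cell [comp]: "computable a \<Longrightarrow> computable (\<lambda>e. skip_cell (input e) (a e))"
  unfolding skip_cell_def skip_int_def skip_nat_def by (intro comp)

lemma computable1_skip_cell [comp]: "computable1 skip_cell"
  unfolding computable1_def by (intro comp)

lemma computable_skip_cells [comp]: "computable a \<Longrightarrow> computable (\<lambda>e. skip_cells (input e) (a e))"
  unfolding skip_cells_def by (intro comp)

lemma computable1_skip_cells [comp]: "computable1 skip_cells"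
  unfolding computable1_def by (intro comp)

lemma decidable_same [comp]:
  assumes "computable i" "computable j"
  shows "decidable (\<lambda>e. same (input e) (i e) (j e))"
  unfolding same_def
  by (intro comp computable_outer[OF assms(1)] computable_outer[OF assms(2)]; (simp only: input_outer)?)+

lemma computable_nat_at [comp]:
  assumes "computable a"
  shows "computable (\<lambda>e. nat_at (input e) (a e))"
  unfolding nat_at_def
  by (intro comp computable_rec assms, simp only: input_outer)
    (intro comp computable_outer[OF computable_outer[OF assms]])

lemma computable_positions [comp]:
  "computable (\<lambda>e. frame_length (input e))" "computable (\<lambda>e. piece_count (input e))"
  "computable (\<lambda>e. index (input e))" "computable (\<lambda>e. goal_at (input e))"
  unfolding frame_length_def piece_count_def pieces_at_def index_def index_at_def goal_at_def skip_nat_def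
  by (intro comp)+

lemma computable_piece [comp]: "computable i \<Longrightarrow> computable (\<lambda>e. piece (input e) (i e))"
  unfolding piece_def pieces_at_def by (intro comp)

lemma computable_size_at [comp]: "computable a \<Longrightarrow> computable (\<lambda>e. size_at (input e) (a e))"
  unfolding size_at_def by (intro comp)

lemma computable_offset [comp]:
  assumes "computable a"
  shows "computable (\<lambda>e. offset (input e) (a e))"
  unfolding offset_def
  by (intro comp computable_outer[OF assms]; (simp only: input_outer)?)+

lemma computable_free [comp]: "computable (\<lambda>e. free (input e))"
  unfolding free_def by (intro comp; (simp only: input_outer)?)+

lemma computable_large_left [comp]:
  assumes "computable x"
  shows "computable (\<lambda>e. large_left (input e) (x e))"
  unfolding large_left_def
  by (intro comp computable_outer[OF assms]; (simp only: input_outer)?)+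

lemma computable_small_total [comp]: "computable (\<lambda>e. small_total (input e))"
  unfolding small_total_def by (intro comp; (simp only: input_outer)?)+

lemma decidable_goal_inside [comp]: "decidable (\<lambda>e. goal_inside (input e))"
  unfolding goal_inside_def by (intro comp; (simp only: input_outer)?)+

lemma decidable_accepts: "decidable (\<lambda>e. accepts (input e))"
  unfolding accepts_def by (intro comp; (simp only: input_outer)?)+

section \<open>Reading the encoding\<close>

definition at :: "bool list \<Rightarrow> nat \<Rightarrow> bool list \<Rightarrow> bool" where
  "at w i u \<longleftrightarrow> (\<exists>x y. w = x @ u @ y \<and> length x = i)"

lemma at_appendD:
  assumes "at w i (u @ v)"
  shows "at w i u" "at w (i + length u) v"
proof -
  obtain x y where w: "w = x @ (u @ v) @ y" "length x = i" using assms unfolding at_def by blast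
  then have "w = x @ u @ (v @ y)" "w = (x @ u) @ v @ y" "length (x @ u) = i + length u" by auto
  then show "at w i u" "at w (i + length u) v" using w(2) unfolding at_def by blast+
qed

lemma at_ConsD: "at w i (b # u) \<Longrightarrow> bit w i = b \<and> i < length w \<and> at w (Suc i) u"
proof -
  assume a: "at w i (b # u)"
  then have "bit w i = b \<and> i < length w" unfolding at_def bit_def by auto
  then show ?thesis using at_appendD(2)[of w i "[b]" u] a by simp
qed

lemma at_length: "at w i u \<Longrightarrow> i + length u \<le> length w"
  unfolding at_def by auto

lemma at_bit: "at w i u \<Longrightarrow> k < length u \<Longrightarrow> bit w (i + k) = u ! k"
  unfolding at_def bit_def by (auto simp: nth_append)

definition passes :: "(bool list \<Rightarrow> nat \<Rightarrow> nat) \<Rightarrow> bool list \<Rightarrow> ('a \<Rightarrow> bool list) \<Rightarrow> 'a list \<Rightarrow> bool" where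
  "passes F w e xs \<longleftrightarrow> (\<forall>x\<in>set xs. \<forall>j. at w j (e x) \<longrightarrow> F w j = j + length (e x))"

lemma enc_list_simps:
  "enc_list e [] = [False]" "enc_list e (x # xs) = True # e x @ enc_list e xs"
  unfolding enc_list_def by auto

lemma length_enc_list: "length xs < length (enc_list e xs)"
  by (induction xs) (auto simp: enc_list_simps)

lemma walk_enc_list:
  assumes "at w i (enc_list e xs)" "passes F w e xs"
  shows "at w (walk F w i j) (enc_list e (drop j xs)) \<and>
    walk F w i j + length (enc_list e (drop j xs)) = i + length (enc_list e xs)"
proof (induction j)
  case 0
  then show ?case using assms(1) unfolding walk_def by simp
next
  case (Suc j)
  let ?p = "walk F w i j"
  have S: "walk F w i (Suc j) = (if bit w ?p then F w (sc w ?p) else ?p)"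
    unfolding walk_def by simp
  show ?case
  proof (cases "drop j xs")
    case Nil
    then have "bit w ?p = False" using Suc at_ConsD[of w ?p False "[]"] by (simp add: enc_list_simps)
    moreover have "drop (Suc j) xs = []" using Nil by simp
    ultimately show ?thesis using Suc S Nil by simp
  next
    case (Cons y ys)
    have d: "drop (Suc j) xs = ys" using Cons by (metis drop_Suc list.sel(3) tl_drop)
    have "at w ?p (True # e y @ enc_list e ys)" using Suc Cons by (simp add: enc_list_simps)
    then have b: "bit w ?p" "?p < length w" "at w (Suc ?p) (e y @ enc_list e ys)" using at_ConsD by auto
    have "y \<in> set xs" using Cons by (metis in_set_dropD list.set_intros(1))
    then have "F w (Suc ?p) = Suc ?p + length (e y)"
      using assms(2) at_appendD(1)[OF b(3)] unfolding passes_def by blast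
    moreover have "sc w ?p = Suc ?p" using b(2) unfolding sc_def by simp
    ultimately have "walk F w i (Suc j) = Suc ?p + length (e y)" using S b(1) by simp
    then show ?thesis using at_appendD(2)[OF b(3)] Suc Cons unfolding d by (simp add: enc_list_simps)
  qed
qed

lemma bit_walk:
  assumes "at w i (enc_list e xs)" "passes F w e xs"
  shows "bit w (walk F w i j) \<longleftrightarrow> j < length xs"
proof (cases "drop j xs")
  case Nil
  then show ?thesis using walk_enc_list[OF assms, of j] at_ConsD[of w _ False "[]"] by (auto simp: enc_list_simps)
next
  case (Cons y ys)
  then have "j < length xs" by (metis drop_all leI list.distinct(1))
  then show ?thesis using walk_enc_list[OF assms, of j] Cons at_ConsD[of w _ True] by (auto simp: enc_list_simps)
qed

lemma at_item:
  assumes "at w i (enc_list e xs)" "passes F w e xs" "j < length xs"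
  shows "at w (item F w i j) (e (xs ! j))"
proof -
  have "at w (walk F w i j) (True # e (xs ! j) @ enc_list e (drop (Suc j) xs))"
    using walk_enc_list[OF assms(1,2), of j] assms(3) by (simp add: enc_list_simps flip: Cons_nth_drop_Suc)
  then show ?thesis
    unfolding item_def sc_def using at_ConsD at_appendD(1) by (metis Suc_leI min_absorb2)
qed

lemma skip_enc_list:
  assumes "at w i (enc_list e xs)" "passes F w e xs"
  shows "skip F w i = i + length (enc_list e xs)"
proof -
  have "length xs \<le> length w" using at_length[OF assms(1)] length_enc_list[of xs e] by simp
  then have "walk F w i (length w) + 1 = i + length (enc_list e xs)"
    using walk_enc_list[OF assms, of "length w"] by (simp add: enc_list_simps)
  then show ?thesis using at_length[OF assms(1)] unfolding skip_def sc_def by simp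
qed

lemma count_enc_list:
  assumes "at w i (enc_list e xs)" "passes F w e xs"
  shows "count F w i = length xs"
proof -
  have le: "length xs \<le> length w" using at_length[OF assms(1)] length_enc_list[of xs e] by simp
  have "(\<Sum>j<length w. of_bool (bit w (walk F w i j))) = (\<Sum>j<length w. of_bool (j < length xs) :: nat)"
    using bit_walk[OF assms] by simp
  also have "\<dots> = (\<Sum>j<length xs. 1)"
    by (rule sum.mono_neutral_cong_right) (use le in auto)
  finally show ?thesis using le unfolding count_def csum_def by simp
qed

fun nat_bits :: "nat \<Rightarrow> bool list" where
  "nat_bits n = (if n = 0 then [] else odd n # nat_bits (n div 2))"

declare nat_bits.simps [simp del] enc_nat.simps [simp del]

lemma enc_nat_eq_enc_list: "enc_nat n = enc_list (\<lambda>b. [b]) (nat_bits n)"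
proof (induction n rule: nat_bits.induct)
  case (1 n)
  then show ?case
    using enc_nat.simps[of n] nat_bits.simps[of n] by (cases "n = 0") (simp_all add: enc_list_simps)
qed

lemma passes_sc: "passes sc w (\<lambda>b. [b]) bs"
  unfolding passes_def using at_ConsD unfolding sc_def by fastforce

lemma skip_nat_enc_nat: "at w i (enc_nat n) \<Longrightarrow> skip_nat w i = i + length (enc_nat n)"
  unfolding skip_nat_def enc_nat_eq_enc_list using skip_enc_list passes_sc by blast

lemma div_nat_bits: "n div 2 ^ length (nat_bits n) = 0"
proof (induction n rule: nat_bits.induct)
  case (1 n)
  then show ?case using nat_bits.simps[of n] by (cases "n = 0") (simp_all add: div_mult2_eq)
qed

lemma nth_nat_bits: "j < length (nat_bits n) \<Longrightarrow> nat_bits n ! j = odd (n div 2 ^ j)"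
proof (induction n arbitrary: j rule: nat_bits.induct)
  case (1 n)
  have "n \<noteq> 0" using "1.prems" nat_bits.simps[of 0] by (cases "n = 0") auto
  then have e: "nat_bits n = odd n # nat_bits (n div 2)" using nat_bits.simps[of n] by simp
  show ?case using 1 \<open>n \<noteq> 0\<close> unfolding e by (cases j) (auto simp: div_mult2_eq)
qed

lemma nat_at_enc_nat:
  assumes "at w i (enc_nat n)" "n \<le> length w"
  shows "nat_at w i = n"
proof -
  let ?bs = "nat_bits n"
  let ?T = "length ?bs"
  have a: "at w i (enc_list (\<lambda>b. [b]) ?bs)" using assms(1) unfolding enc_nat_eq_enc_list .
  have T: "count sc w i = ?T" using count_enc_list[OF a passes_sc] .
  have "rec_nat 0 (\<lambda>t v. pl w (pl w v v) (of_bool (bit w (item sc w i (?T - t - 1))))) t = n div 2 ^ (?T - t)"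
    if "t \<le> ?T" for t
    using that
  proof (induction t)
    case 0
    then show ?case using div_nat_bits by simp
  next
    case (Suc t)
    define j where "j = ?T - Suc t"
    have j: "?T - t = Suc j" "?T - Suc t = j" "j < ?T" using Suc.prems unfolding j_def by auto
    have "bit w (item sc w i j) = ?bs ! j" using at_item[OF a passes_sc j(3)] at_ConsD by simp
    then have b: "bit w (item sc w i j) = odd (n div 2 ^ j)" using nth_nat_bits[OF j(3)] by simp
    have d: "n div 2 ^ Suc j = n div 2 ^ j div 2" by (metis div_mult2_eq power_Suc2)
    have le: "n div 2 ^ j \<le> length w" using assms(2) div_le_dividend le_trans by blast
    have "2 * (m div 2) + of_bool (odd m) = m" for m :: nat by (cases "odd m") auto
    from this[of "n div 2 ^ j"]
    have "pl w (pl w (n div 2 ^ j div 2) (n div 2 ^ j div 2)) (of_bool (odd (n div 2 ^ j))) = n div 2 ^ j"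
      using le unfolding pl_def by (auto simp: min_def)
    then show ?case using Suc j b d by simp
  qed
  from this[of ?T] show ?thesis unfolding nat_at_def T by simp
qed

lemma skip_int_enc_int: "at w i (enc_int k) \<Longrightarrow> skip_int w i = i + length (enc_int k)"
  using skip_nat_enc_nat at_ConsD unfolding enc_int_def skip_int_def sc_def by fastforce

lemma skip_cell_enc_cell: "at w i (enc_cell c) \<Longrightarrow> skip_cell w i = i + length (enc_cell c)"
  using at_appendD skip_int_enc_int unfolding enc_cell_def skip_cell_def by fastforce

lemma passes_skip_cell: "passes skip_cell w enc_cell cs"
  unfolding passes_def using skip_cell_enc_cell by blast

lemma skip_cells_enc_cellset: "at w i (enc_cellset S) \<Longrightarrow> skip_cells w i = i + length (enc_cellset S)"
  unfolding enc_cellset_def skip_cells_def using skip_enc_list passes_skip_cell by blast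

lemma passes_skip_cells: "passes skip_cells w enc_cellset Ss"
  unfolding passes_def using skip_cells_enc_cellset by blast

lemma enc_nat_prefix_free: "enc_nat m @ x = enc_nat n @ y \<Longrightarrow> m = n \<and> x = y"
proof (induction m arbitrary: n rule: enc_nat.induct)
  case (1 m)
  show ?case
  proof (cases "m = 0 \<or> n = 0")
    case True
    then show ?thesis using "1.prems" enc_nat.simps[of m] enc_nat.simps[of n] by (auto split: if_splits)
  next
    case False
    then have "odd m = odd n" "enc_nat (m div 2) @ x = enc_nat (n div 2) @ y"
      using "1.prems" enc_nat.simps[of m] enc_nat.simps[of n] by auto
    moreover from this have "m div 2 = n div 2 \<and> x = y" using "1.IH" False by blast
    ultimately show ?thesis by (metis even_two_times_div_two odd_two_times_div_two_succ)
  qed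
qed

lemma enc_cell_prefix_free: "enc_cell c @ x = enc_cell d @ y \<Longrightarrow> c = d"
proof -
  have int: "k = l \<and> x = y" if "enc_int k @ x = enc_int l @ y" for k l x y
    using that enc_nat_prefix_free[of "nat \<bar>k\<bar>" x "nat \<bar>l\<bar>" y] unfolding enc_int_def by auto
  assume "enc_cell c @ x = enc_cell d @ y"
  then show ?thesis using int unfolding enc_cell_def by (metis append_assoc prod.collapse)
qed

lemma same_enc_cell:
  assumes c: "at w i (enc_cell c)" and d: "at w j (enc_cell d)"
  shows "same w i j \<longleftrightarrow> c = d"
proof -
  have bit_min: "bit w (pl w a k) = bit w (a + k)" for a k unfolding pl_def bit_def by auto
  let ?L = "length (enc_cell c)"
  have L: "i + ?L \<le> length w" using at_length[OF c] .
  have "same w i j \<longleftrightarrow> (\<forall>k<?L. bit w (i + k) = bit w (j + k))"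
    unfolding same_def bit_min skip_cell_enc_cell[OF c] using L
    by (auto simp: pl_def min_def split: if_splits)
  also have "\<dots> \<longleftrightarrow> c = d"
  proof
    assume "c = d"
    then show "\<forall>k<?L. bit w (i + k) = bit w (j + k)" using at_bit[OF c] at_bit[OF d] by simp
  next
    assume eq: "\<forall>k<?L. bit w (i + k) = bit w (j + k)"
    obtain x y where w: "w = x @ enc_cell d @ y" "length x = j" using d unfolding at_def by blast
    let ?z = "enc_cell d @ y @ replicate ?L False"
    have "enc_cell c = take ?L ?z"
    proof (rule nth_equalityI)
      fix k assume k: "k < ?L"
      have "bit w (j + k) = ?z ! k"
        unfolding bit_def w(1) using k by (auto simp: nth_append w(2))
      then show "enc_cell c ! k = take ?L ?z ! k" using eq k at_bit[OF c k] by (simp del: take_append)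
    qed simp
    then have "enc_cell c @ drop ?L ?z = enc_cell d @ (y @ replicate ?L False)"
      by (metis append_take_drop_id)
    then show "c = d" using enc_cell_prefix_free by blast
  qed
  finally show ?thesis .
qed

locale encoded =
  fixes F :: "cell set" and init :: "cell set list" and p :: nat and goal :: "cell set"
  assumes F: "finite F" and goal: "finite goal" "goal \<noteq> {}" and p: "p < length init"
begin

definition w :: "bool list" where "w = enc_instance (F, init, p, goal)"

lemma at_F: "at w 0 (enc_cellset F)"
  and at_pieces: "at w (pieces_at w) (enc_list enc_cellset init)"
  and at_p: "at w (index_at w) (enc_nat p)"
  and at_goal: "at w (goal_at w) (enc_cellset goal)"
proof -
  have "at w 0 (enc_cellset F @ enc_list enc_cellset init @ enc_nat p @ enc_cellset goal)"
    unfolding w_def enc_instance_def at_def by simp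
  note 1 = at_appendD[OF this]
  show "at w 0 (enc_cellset F)" by fact
  have "pieces_at w = 0 + length (enc_cellset F)"
    unfolding pieces_at_def using skip_cells_enc_cellset 1(1) by blast
  note 2 = at_appendD[OF 1(2)[folded this]]
  show "at w (pieces_at w) (enc_list enc_cellset init)" by fact
  have "index_at w = pieces_at w + length (enc_list enc_cellset init)"
    unfolding index_at_def using skip_enc_list[OF 2(1) passes_skip_cells] .
  note 3 = at_appendD[OF 2(2)[folded this]]
  show "at w (index_at w) (enc_nat p)" by fact
  have "goal_at w = index_at w + length (enc_nat p)"
    unfolding goal_at_def using skip_nat_enc_nat[OF 3(1)] .
  then show "at w (goal_at w) (enc_cellset goal)" using 3(2) by simp
qed

lemma at_cells: "at w a (enc_cellset S) \<Longrightarrow> at w a (enc_list enc_cell (sorted_list_of_set S))"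
  unfolding enc_cellset_def .

lemma size_at_eq: "at w a (enc_cellset S) \<Longrightarrow> size_at w a = card S"
  unfolding size_at_def using count_enc_list[OF at_cells passes_skip_cell] by simp

lemma frame_length_eq: "frame_length w = card F"
  using size_at_eq[OF at_F] unfolding frame_length_def size_at_def .

lemma piece_count_eq: "piece_count w = length init"
  unfolding piece_count_def using count_enc_list[OF at_pieces passes_skip_cells] .

lemma at_piece: "i < length init \<Longrightarrow> at w (piece w i) (enc_cellset (init ! i))"
  unfolding piece_def using at_item[OF at_pieces passes_skip_cells] .

lemma length_ge: "length init < length w" "card F < length w"
  using at_length[OF at_pieces] length_enc_list[of init enc_cellset]
    at_length[OF at_cells[OF at_F]] length_enc_list[of "sorted_list_of_set F" enc_cell] by auto

lemma index_eq: "index w = p"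
  unfolding index_def using nat_at_enc_nat[OF at_p] p length_ge(1) by simp

lemma same_item:
  assumes "at w a (enc_cellset S)" "k < card S" "j < card F"
  shows "same w (item skip_cell w 0 j) (item skip_cell w a k)
    \<longleftrightarrow> sorted_list_of_set F ! j = sorted_list_of_set S ! k"
  using same_enc_cell at_item[OF at_cells[OF assms(1)] passes_skip_cell, of k]
    at_item[OF at_cells[OF at_F] passes_skip_cell, of j] assms(2,3) by simp

lemma offset_eq:
  assumes a: "at w a (enc_cellset S)" and S: "finite S" "S \<noteq> {}" and s: "s < card F"
    "sorted_list_of_set F ! s = sorted_list_of_set S ! 0"
  shows "offset w a = s"
proof -
  have "0 < card S" using S by (simp add: card_gt_0_iff)
  have same: "same w (item skip_cell w 0 j) (item skip_cell w a 0) \<longleftrightarrow> j = s" if "j < card F" for j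
    using same_item[OF a \<open>0 < card S\<close> that] s that F nth_eq_iff_index_eq[of "sorted_list_of_set F" j s]
    by simp
  have "(\<Sum>j<card F. if same w (item skip_cell w 0 j) (item skip_cell w a 0) then j else 0)
      = (\<Sum>j<card F. if j = s then j else 0)"
    using same by (intro sum.cong) auto
  also have "\<dots> = s" using s(1) by simp
  finally show ?thesis
    using s(1) length_ge(2) unfolding offset_def csum_def frame_length_eq by simp
qed

lemma goal_inside_iff: "goal_inside w \<longleftrightarrow> goal \<subseteq> F"
proof -
  have "goal_inside w \<longleftrightarrow> (\<forall>k<card goal. \<exists>j<card F. sorted_list_of_set F ! j = sorted_list_of_set goal ! k)"
    unfolding goal_inside_def size_at_eq[OF at_goal] frame_length_eq
    using same_item[OF at_goal] by blast
  also have "\<dots> \<longleftrightarrow> (\<forall>k<card goal. sorted_list_of_set goal ! k \<in> F)"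
    using F in_set_conv_nth[of _ "sorted_list_of_set F"] by auto
  also have "\<dots> \<longleftrightarrow> goal \<subseteq> F"
    using goal all_set_conv_all_nth[of "sorted_list_of_set goal" "\<lambda>c. c \<in> F"] by auto
  finally show ?thesis .
qed

end

section \<open>Packings of a strip\<close>

definition strip :: "bool \<Rightarrow> cell \<Rightarrow> nat \<Rightarrow> cell" where
  "strip v c i = (if v then (fst c, snd c + int i) else (fst c + int i, snd c))"

lemma width1_rectangle_strip:
  assumes "width1_rectangle F"
  shows "\<exists>v c n. F = strip v c ` {..<n}"
proof -
  have img: "(\<lambda>i. a + int i) ` {..<nat n} = {a..<a + n}" if "n \<ge> 1" for a n :: int
  proof
    show "{a..<a + n} \<subseteq> (\<lambda>i. a + int i) ` {..<nat n}"
    proof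
      fix x assume "x \<in> {a..<a + n}"
      then show "x \<in> (\<lambda>i. a + int i) ` {..<nat n}" by (intro image_eqI[of _ _ "nat (x - a)"]) auto
    qed
  qed auto
  obtain a b n where n: "n \<ge> 1" "F = {a..<a+n} \<times> {b} \<or> F = {a} \<times> {b..<b+n}"
    using assms unfolding width1_rectangle_def by blast
  then consider "F = (\<lambda>i. a + int i) ` {..<nat n} \<times> {b}" | "F = {a} \<times> (\<lambda>i. b + int i) ` {..<nat n}"
    using img[OF n(1)] by metis
  then show ?thesis
  proof cases
    case 1
    then have "F = strip False (a, b) ` {..<nat n}" unfolding strip_def by auto
    then show ?thesis by blast
  next
    case 2
    then have "F = strip True (a, b) ` {..<nat n}" unfolding strip_def by auto
    then show ?thesis by blast
  qed
qed

lemma strip_inj: "strip v c i = strip v c j \<longleftrightarrow> i = j"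
  unfolding strip_def by auto

lemma inj_strip: "inj (strip v c)"
  unfolding inj_def by (simp add: strip_inj)

lemma strip_less: "i < j \<Longrightarrow> strip v c i < strip v c j"
  unfolding strip_def less_prod_def by auto

lemma adjacent_strip: "adjacent (strip v c i) (strip v c j) \<longleftrightarrow> i = Suc j \<or> j = Suc i"
  unfolding adjacent_def strip_def by auto

lemma sorted_list_of_strip: "sorted_list_of_set (strip v c ` {a..<b}) = map (strip v c) [a..<b]"
proof -
  have "sorted_wrt (<) (map (strip v c) [a..<b])"
    unfolding sorted_wrt_map by (rule sorted_wrt_mono_rel[OF _ sorted_wrt_upt]) (use strip_less in auto)
  then have "sorted (map (strip v c) [a..<b])" "distinct (map (strip v c) [a..<b])"
    using strict_sorted_iff by blast+
  then show ?thesis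
    using sorted_list_of_set.idem_if_sorted_distinct by (metis list.set_map set_upt)
qed

lemma polyomino_in_strip:
  assumes S: "polyomino S" "S \<subseteq> strip v c ` {..<n}"
  shows "\<exists>s l. 0 < l \<and> s + l \<le> n \<and> S = strip v c ` {s..<s + l}"
proof -
  let ?c = "strip v c"
  define I where "I = {i. i < n \<and> ?c i \<in> S}"
  have SI: "S = ?c ` I" using S(2) unfolding I_def by auto
  have fin: "finite I" unfolding I_def by simp
  have ne: "I \<noteq> {}" using SI S(1) unfolding polyomino_def by auto
  let ?s = "Min I" and ?M = "Max I"
  have sM: "?s \<in> I" "?M \<in> I" "?s \<le> ?M" using fin ne by auto
  have between: "k \<in> I" if k: "?s \<le> k" "k \<le> ?M" for k
  proof (rule ccontr)
    assume no: "k \<notin> I"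
    let ?R = "\<lambda>x y. x \<in> S \<and> y \<in> S \<and> adjacent x y"
    have "?R\<^sup>*\<^sup>* (?c ?s) (?c ?M)" using S(1) sM SI unfolding polyomino_def by blast
    then have "\<exists>i<k. ?c ?M = ?c i"
    proof (induction rule: rtranclp_induct)
      case base
      have "?s \<noteq> k" using no sM(1) by metis
      then show ?case using k(1) by (intro exI[of _ ?s]) simp
    next
      case (step x y)
      then obtain i where i: "i < k" "x = ?c i" by blast
      obtain j where j: "j \<in> I" "y = ?c j" using step(2) SI by blast
      have "i = Suc j \<or> j = Suc i" using step(2) i(2) j(2) adjacent_strip by simp
      moreover have "j \<noteq> k" using no j(1) by blast
      ultimately show ?case using i(1) j(2) by (intro exI[of _ j]) auto
    qed
    then show False using k(2) by (simp add: strip_inj)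
  qed
  have "?M < n" using sM(2) unfolding I_def by blast
  define s l where "s = ?s" and "l = Suc ?M - ?s"
  have "i \<in> I \<longleftrightarrow> i \<in> {s..<s + l}" for i
    using between[of i] Min_le[OF fin, of i] Max_ge[OF fin, of i] sM(3) unfolding s_def l_def by fastforce
  then have "S = strip v c ` {s..<s + l}" using SI by blast
  moreover have "s + l \<le> n" "0 < l" using \<open>?M < n\<close> sM(3) unfolding s_def l_def by simp_all
  ultimately show ?thesis by blast
qed

lemma adjacent_rot90: "adjacent ((rot90 ^^ k) x) ((rot90 ^^ k) y) \<longleftrightarrow> adjacent x y"
proof (induction k)
  case (Suc k)
  have "adjacent (rot90 a) (rot90 b) \<longleftrightarrow> adjacent a b" for a b
    unfolding adjacent_def rot90_def by auto
  then show ?case using Suc by simp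
qed simp

lemma rot90_inj: "(rot90 ^^ k) x = (rot90 ^^ k) y \<longleftrightarrow> x = y"
proof (induction k)
  case (Suc k)
  have "rot90 a = rot90 b \<longleftrightarrow> a = b" for a b
    unfolding rot90_def by (auto simp: prod_eq_iff)
  then show ?case using Suc by simp
qed simp

lemma placement_of_polyomino:
  assumes "polyomino S" "placement_of S T"
  shows "polyomino T \<and> card T = card S"
proof -
  obtain k a b where T: "T = (\<lambda>c. (fst ((rot90 ^^ k) c) + a, snd ((rot90 ^^ k) c) + b)) ` S"
    using assms(2) unfolding placement_of_def by blast
  define g where "g = (\<lambda>c. (fst ((rot90 ^^ k) c) + a, snd ((rot90 ^^ k) c) + b))"
  have T: "T = g ` S" using T unfolding g_def .
  have inj: "inj g"
  proof (rule injI)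
    fix x y assume "g x = g y"
    then have "(rot90 ^^ k) x = (rot90 ^^ k) y" unfolding g_def by (simp add: prod_eq_iff)
    then show "x = y" using rot90_inj by simp
  qed
  have adj: "adjacent (g x) (g y) \<longleftrightarrow> adjacent x y" for x y
  proof -
    have "adjacent (g x) (g y) \<longleftrightarrow> adjacent ((rot90 ^^ k) x) ((rot90 ^^ k) y)"
      unfolding g_def adjacent_def by simp
    then show ?thesis using adjacent_rot90 by simp
  qed
  let ?R = "\<lambda>S u v. u \<in> S \<and> v \<in> S \<and> adjacent u v"
  have path: "(?R T)\<^sup>*\<^sup>* (g x) (g y)" if "(?R S)\<^sup>*\<^sup>* x y" for x y
    using that
  proof (induction rule: rtranclp_induct)
    case (step y z)
    then have "?R T (g y) (g z)" using adj T by blast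
    then show ?case using step.IH by (rule rtranclp.rtrancl_into_rtrancl[rotated])
  qed simp
  have "finite T" "T \<noteq> {}" using assms(1) T unfolding polyomino_def by auto
  moreover have "(?R T)\<^sup>*\<^sup>* x y" if xy: "x \<in> T" "y \<in> T" for x y
  proof -
    obtain x' y' where "x' \<in> S" "y' \<in> S" "x = g x'" "y = g y'" using xy unfolding T by blast
    then show ?thesis using path assms(1) unfolding polyomino_def by blast
  qed
  ultimately have "polyomino T" unfolding polyomino_def by blast
  moreover have "card T = card S" unfolding T using inj_on_subset[OF inj subset_UNIV] by (rule card_image)
  ultimately show ?thesis by blast
qed

lemma placement_of_strip: "placement_of (strip v c ` {s..<s + l}) (strip v c ` {t..<t + l})"
proof -
  define a where "a = (if v then 0 else int t - int s)"
  define b where "b = (if v then int t - int s else 0)"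
  let ?g = "\<lambda>x. (fst ((rot90 ^^ 0) x) + a, snd ((rot90 ^^ 0) x) + b)"
  have g: "?g (strip v c (s + i)) = strip v c (t + i)" for i
    unfolding strip_def a_def b_def by simp
  have shift: "{u..<u + l} = (\<lambda>i. u + i) ` {..<l}" for u
    using image_add_atLeastLessThan[of u 0 l] by (simp add: atLeast0LessThan add.commute)
  have "strip v c ` {t..<t + l} = ?g ` (strip v c ` {s..<s + l})"
    unfolding shift image_image g by simp
  then show ?thesis unfolding placement_of_def
    by (intro exI[of _ "0::nat"] conjI exI[of _ a] exI[of _ b]) simp_all
qed

locale strip_puzzle = line n m l for n m :: nat and l :: "nat \<Rightarrow> nat" +
  fixes v :: bool and c :: cell
begin

definition segment :: "nat \<Rightarrow> nat \<Rightarrow> cell set" where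
  "segment s k = strip v c ` {s..<s + k}"

definition frame :: "cell set" where
  "frame = strip v c ` {..<n}"

definition packing :: "(nat \<Rightarrow> nat) \<Rightarrow> cell set list" where
  "packing s = map (\<lambda>i. segment (s i) (l i)) [0..<m]"

lemma packing_nth: "i < m \<Longrightarrow> packing s ! i = segment (s i) (l i)"
  unfolding packing_def by simp

lemma length_packing: "length (packing s) = m"
  unfolding packing_def by simp

lemma segment_inj: "0 < k \<Longrightarrow> segment s k = segment t k \<longleftrightarrow> s = t"
  unfolding segment_def inj_image_eq_iff[OF inj_strip] by (simp add: atLeastLessThan_eq_iff)

lemma segment_subset: "0 < k \<Longrightarrow> segment s k \<subseteq> frame \<longleftrightarrow> s + k \<le> n"
proof -
  assume k: "0 < k"
  have "segment s k \<subseteq> frame \<longleftrightarrow> {s..<s + k} \<subseteq> {..<n}"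
    unfolding segment_def frame_def inj_image_subset_iff[OF inj_strip] ..
  also have "\<dots> \<longleftrightarrow> s + k \<le> n"
  proof
    assume "{s..<s + k} \<subseteq> {..<n}"
    moreover have "s + k - 1 \<in> {s..<s + k}" using k by simp
    ultimately have "s + k - 1 \<in> {..<n}" by (rule subsetD)
    then show "s + k \<le> n" using k by simp
  qed auto
  finally show ?thesis .
qed

lemma segment_disjoint:
  assumes "0 < k" "0 < j"
  shows "segment s k \<inter> segment t j = {} \<longleftrightarrow> s + k \<le> t \<or> t + j \<le> s"
proof -
  have "segment s k \<inter> segment t j = strip v c ` ({s..<s + k} \<inter> {t..<t + j})"
    unfolding segment_def using image_Int[OF inj_strip] by (simp only:)
  then have "segment s k \<inter> segment t j = {} \<longleftrightarrow> {s..<s + k} \<inter> {t..<t + j} = {}"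
    by (simp only: image_is_empty)
  also have "\<dots> \<longleftrightarrow> s + k \<le> t \<or> t + j \<le> s"
    using assms by (simp only: Int_atLeastLessThan atLeastLessThan_empty_iff) linarith
  finally show ?thesis .
qed

lemma card_segment: "card (segment s k) = k"
  unfolding segment_def card_image[OF inj_on_subset[OF inj_strip subset_UNIV]] by simp

lemma feasible_iff: "feasible frame (packing s) \<longleftrightarrow> fits s"
proof -
  have "(\<forall>i<m. packing s ! i \<subseteq> frame) \<longleftrightarrow> (\<forall>i<m. s i + l i \<le> n)"
    using segment_subset[OF l_pos] by (simp add: packing_nth)
  moreover have "packing s ! i \<inter> packing s ! j = {} \<longleftrightarrow> apart s i j" if "i < m" "j < m" for i j
    unfolding packing_nth[OF that(1)] packing_nth[OF that(2)] apart_def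
    by (rule segment_disjoint[OF l_pos[OF that(1)] l_pos[OF that(2)]])
  ultimately show ?thesis unfolding feasible_def fits_def length_packing by (simp cong: conj_cong imp_cong)
qed

lemma hop_fly:
  assumes "hop s t"
  shows "fly frame (packing s) (packing t)"
proof -
  obtain i where i: "i < m" "\<forall>j<m. j \<noteq> i \<longrightarrow> t j = s j" "fits t" using assms unfolding hop_def by blast
  then have "placement_of (packing s ! i) (packing t ! i)"
    using placement_of_strip by (simp only: packing_nth segment_def)
  moreover have "\<forall>j<m. j \<noteq> i \<longrightarrow> packing t ! j = packing s ! j" using i(2) by (simp add: packing_nth)
  ultimately show ?thesis unfolding fly_def length_packing feasible_iff using i by blast
qed

lemma fly_hop:
  assumes s: "fits s" and pol: "\<And>i. i < m \<Longrightarrow> polyomino (packing s ! i)" and "fly frame (packing s) cs"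
  shows "\<exists>t. cs = packing t \<and> hop s t"
proof -
  obtain i where len: "length cs = m" and feas: "feasible frame cs" and i: "i < m"
    and pl: "placement_of (packing s ! i) (cs ! i)" and same: "\<And>j. j < m \<Longrightarrow> j \<noteq> i \<Longrightarrow> cs ! j = packing s ! j"
    using assms(3) unfolding fly_def length_packing by blast
  have pc: "polyomino (cs ! i)" "card (cs ! i) = l i"
    using placement_of_polyomino[OF pol[OF i] pl] i by (simp_all add: packing_nth card_segment)
  have "cs ! i \<subseteq> strip v c ` {..<n}" using feas i len unfolding feasible_def frame_def by simp
  then obtain t' k where t': "cs ! i = segment t' k"
    using polyomino_in_strip[OF pc(1)] unfolding segment_def by blast
  then have "k = l i" using pc(2) card_segment by simp
  define t where "t = s(i := t')"
  have "cs = packing t"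
  proof (rule nth_equalityI)
    fix j assume "j < length cs"
    then show "cs ! j = packing t ! j"
      using same[of j] t' \<open>k = l i\<close> len unfolding t_def by (auto simp: packing_nth)
  qed (simp add: len length_packing)
  moreover have "hop s t"
    using feas i unfolding \<open>cs = packing t\<close> feasible_iff hop_def by (auto simp: t_def)
  ultimately show ?thesis by blast
qed

lemma flies_iff_hops:
  assumes s: "fits s" and pol: "\<And>i. i < m \<Longrightarrow> polyomino (packing s ! i)"
  shows "(fly frame)\<^sup>*\<^sup>* (packing s) cs \<longleftrightarrow> (\<exists>t. cs = packing t \<and> hop\<^sup>*\<^sup>* s t)"
proof
  assume "(fly frame)\<^sup>*\<^sup>* (packing s) cs"
  then have "\<exists>t. cs = packing t \<and> hop\<^sup>*\<^sup>* s t \<and> (\<forall>i<m. polyomino (packing t ! i))"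
  proof (induction rule: rtranclp_induct)
    case base
    then show ?case using pol by blast
  next
    case (step ds cs)
    then obtain t where t: "ds = packing t" "hop\<^sup>*\<^sup>* s t" "\<And>i. i < m \<Longrightarrow> polyomino (packing t ! i)" by blast
    have ft: "fits t" using hops_fits[OF t(2) s] .
    obtain u where u: "cs = packing u" "hop t u" using fly_hop[OF ft t(3)] step(2) unfolding t(1) by blast
    have "polyomino (packing u ! i)" if "i < m" for i
    proof -
      have "placement_of (packing t ! i) (packing u ! i)"
        using placement_of_strip that by (simp only: packing_nth segment_def)
      then show ?thesis using placement_of_polyomino t(3)[OF that] by blast
    qed
    moreover have "hop\<^sup>*\<^sup>* s u" using t(2) u(2) by auto
    ultimately show ?case using u(1) by blast
  qed
  then show "\<exists>t. cs = packing t \<and> hop\<^sup>*\<^sup>* s t" by blast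
next
  assume "\<exists>t. cs = packing t \<and> hop\<^sup>*\<^sup>* s t"
  then obtain t where t: "cs = packing t" "hop\<^sup>*\<^sup>* s t" by blast
  have "(fly frame)\<^sup>*\<^sup>* (packing s) (packing t)"
    using t(2)
  proof (induction rule: rtranclp_induct)
    case (step y z)
    then show ?case using hop_fly by (meson rtranclp.rtrancl_into_rtrancl)
  qed simp
  then show "(fly frame)\<^sup>*\<^sup>* (packing s) cs" using t(1) by simp
qed

end

lemma (in strip_puzzle) accepts_iff_solvable:
  assumes s: "fits s" and pol: "\<And>i. i < m \<Longrightarrow> polyomino (packing s ! i)" and pm: "p < m"
    and gpl: "placement_of (packing s ! p) goal"
  shows "accepts (enc_instance (frame, packing s, p, goal)) \<longleftrightarrow> solvable (frame, packing s, p, goal)"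
proof -
  have gp: "polyomino goal" "card goal = l p"
    using placement_of_polyomino[OF pol[OF pm] gpl] pm by (simp_all add: packing_nth card_segment)
  interpret encoded frame "packing s" p goal
  proof
    show "finite frame" unfolding frame_def by simp
    show "finite goal" "goal \<noteq> {}" using gp(1) unfolding polyomino_def by auto
    show "p < length (packing s)" using pm length_packing by simp
  qed
  have solv: "solvable (frame, packing s, p, goal) \<longleftrightarrow> (\<exists>t. hop\<^sup>*\<^sup>* s t \<and> segment (t p) (l p) = goal)"
  proof -
    have flies: "(fly frame)\<^sup>*\<^sup>* (packing s) cs \<longleftrightarrow> (\<exists>t. cs = packing t \<and> hop\<^sup>*\<^sup>* s t)" for cs
      by (rule flies_iff_hops[OF s]) (rule pol)
    have "solvable (frame, packing s, p, goal) \<longleftrightarrow> (\<exists>t. hop\<^sup>*\<^sup>* s t \<and> packing t ! p = goal)"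
      unfolding solvable_def prod.case flies
    proof (intro iffI; elim exE conjE)
      fix t assume "hop\<^sup>*\<^sup>* s t" "packing t ! p = goal"
      then show "\<exists>cs. (\<exists>t. cs = packing t \<and> hop\<^sup>*\<^sup>* s t) \<and> cs ! p = goal"
        by (intro exI[of _ "packing t"] exI[of _ t] conjI refl)
    next
      fix cs t assume "cs ! p = goal" "cs = packing t" "hop\<^sup>*\<^sup>* s t"
      then show "\<exists>t. hop\<^sup>*\<^sup>* s t \<and> packing t ! p = goal" by (intro exI[of _ t]) simp
    qed
    then show ?thesis unfolding packing_nth[OF pm] .
  qed
  show ?thesis
  proof (cases "goal \<subseteq> frame")
    case False
    have "\<not> accepts w" using False goal_inside_iff unfolding accepts_def by simp
    moreover have "segment (t p) (l p) \<subseteq> frame" if "hop\<^sup>*\<^sup>* s t" for t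
      unfolding segment_subset[OF l_pos[OF pm]] by (rule fits_end[OF hops_fits[OF that s] pm])
    ultimately show ?thesis using False solv unfolding w_def by blast
  next
    case True
    obtain y k where y: "goal = segment y k"
      using polyomino_in_strip[OF gp(1) True[unfolded frame_def]] unfolding segment_def by blast
    have k: "k = l p" using gp(2) y card_segment by simp
    have yn: "y + l p \<le> n" using True segment_subset[OF l_pos[OF pm], of y] unfolding y k by simp
    have "segment (t p) (l p) = goal \<longleftrightarrow> t p = y" for t :: "nat \<Rightarrow> nat"
      unfolding y k by (rule segment_inj[OF l_pos[OF pm]])
    then have solv: "solvable (frame, packing s, p, goal) \<longleftrightarrow> (\<exists>t. hop\<^sup>*\<^sup>* s t \<and> t p = y)"
      using solv by (simp only:)
    have cardF: "card frame = n"
      unfolding frame_def card_image[OF inj_on_subset[OF inj_strip subset_UNIV]] by simp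
    have N: "n < length w" "m < length w" using length_ge cardF length_packing by simp_all
    have sortF: "sorted_list_of_set frame ! j = strip v c j" if "j < n" for j
      using that sorted_list_of_strip[of v c 0 n] unfolding frame_def by (simp add: atLeast0LessThan)
    have off: "offset w a = t" if "at w a (enc_cellset (segment t j))" "0 < j" "t + j \<le> n" for a t j
    proof (rule offset_eq[OF that(1)])
      show "finite (segment t j)" "segment t j \<noteq> {}" using that(2) unfolding segment_def by auto
      show "t < card frame" using that cardF by simp
      have "sorted_list_of_set (segment t j) ! 0 = strip v c t"
        using that(2) unfolding segment_def sorted_list_of_strip by simp
      then show "sorted_list_of_set frame ! t = sorted_list_of_set (segment t j) ! 0"
        using sortF that by simp
    qed
    have pieces_enc: "at w (piece w i) (enc_cellset (segment (s i) (l i)))" if "i < m" for i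
      using at_piece[of i] that packing_nth length_packing by simp
    have size: "size_at w (piece w i) = l i" if "i < m" for i
      using size_at_eq[OF pieces_enc[OF that]] card_segment by simp
    have offp: "offset w (piece w i) = s i" if "i < m" for i
      using off[OF pieces_enc[OF that] l_pos[OF that] fits_end[OF s that]] .
    have offg: "offset w (goal_at w) = y"
      using off[of "goal_at w" y "l p"] at_goal l_pos[OF pm] yn unfolding y k by blast
    have pc: "piece_count w = m" using piece_count_eq length_packing by simp
    have tot: "slack + sum l {..<m} = n" using fits_total_length[OF s] unfolding slack_def by simp
    have le: "sum l X \<le> sum l {..<m}" if "X \<subseteq> {..<m}" for X using that by (intro sum_mono2) auto
    have "csum w (piece_count w) (\<lambda>i. size_at w (piece w i)) = sum l {..<m}"
      unfolding csum_def pc using size tot N by simp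
    then have free: "free w = slack"
      unfolding free_def slack_def frame_length_eq cardF by simp
    have sub: "csum w (piece_count w) (\<lambda>i. if Q i then size_at w (piece w i) else 0) = sum l X"
      if X: "X = {i. i < m \<and> Q i}" for Q X
    proof -
      have "(\<Sum>i<m. if Q i then size_at w (piece w i) else 0) = (\<Sum>i<m. if Q i then l i else 0)"
        using size by (intro sum.cong) auto
      also have "\<dots> = sum l ({..<m} \<inter> {i. Q i})" by (subst sum.If_cases) auto
      also have "{..<m} \<inter> {i. Q i} = X" using X by auto
      finally have eq: "(\<Sum>i<m. if Q i then size_at w (piece w i) else 0) = sum l X" .
      have "sum l X \<le> length w" using le[of X] X tot N(1) by fastforce
      then show ?thesis unfolding csum_def pc eq by simp
    qed
    have "large_before s p x = {i. i < m \<and> i \<noteq> p \<and> slack < size_at w (piece w i) \<and> offset w (piece w i) < x}" for x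
      unfolding large_before_def large_def using size offp by (intro set_eqI) auto
    then have ll: "large_left w x = sum l (large_before s p x)" for x
      unfolding large_left_def free index_eq by (intro sub)
    have "small_others p = {i. i < m \<and> i \<noteq> p \<and> \<not> slack < size_at w (piece w i)}"
      unfolding small_others_def large_def using size by (intro set_eqI) auto
    then have st: "small_total w = sum l (small_others p)"
      unfolding small_total_def free index_eq by (intro sub)
    have in_m: "large_before s p x \<subseteq> {..<m}" "small_others p \<subseteq> {..<m}" for x
      unfolding large_before_def small_others_def large_def by auto
    have "sum l (large_before s p x) + sum l (small_others p) = sum l (large_before s p x \<union> small_others p)" for x
    proof (rule sum.union_disjoint[symmetric])
      show "finite (large_before s p x)" "finite (small_others p)"
        using in_m finite_subset by blast+
      show "large_before s p x \<inter> small_others p = {}"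
        unfolding large_before_def small_others_def by blast
    qed
    then have bnd: "sum l (large_before s p x) + sum l (small_others p) \<le> sum l {..<m}" for x
      using le[of "large_before s p x \<union> small_others p"] in_m by simp
    have room: "slack + sum l (large_before s p x) + sum l (small_others p) \<le> length w" for x
      using bnd[of x] tot N(1) by linarith
    have pls: "pl w (pl w slack (sum l (large_before s p x))) (sum l (small_others p))
        = slack + sum l (large_before s p x) + sum l (small_others p)" for x
    proof -
      have "slack + sum l (large_before s p x) \<le> length w" using room[of x] by simp
      then show ?thesis using room[of x] unfolding pl_def by (simp only: min.absorb2)
    qed
    have sc: "sc w n = Suc n" using N unfolding sc_def by simp
    have "accepts w \<longleftrightarrow> (\<exists>x\<le>n. (p \<in> large \<longrightarrow> x = s p) \<and> sum l (large_before s p x) \<le> y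
       \<and> y \<le> slack + sum l (large_before s p x) + sum l (small_others p) \<and> y + l p \<le> n)"
      unfolding accepts_def goal_inside_iff frame_length_eq cardF sc free index_eq size[OF pm] offp[OF pm]
        offg ll st pls using True pm yn by (simp add: large_def less_Suc_eq_le)
    then show ?thesis using reachable_start[OF s pm, of y] solv unfolding w_def by blast
  qed
qed

lemma accepts_iff:
  assumes "valid_instance I" "width1_rectangle (fst I)"
  shows "accepts (enc_instance I) \<longleftrightarrow> solvable I"
proof -
  obtain F init p goal where I: "I = (F, init, p, goal)" by (cases I)
  have "width1_rectangle F" using assms(2) I by simp
  then obtain v c n where F: "F = strip v c ` {..<n}" using width1_rectangle_strip by blast
  define m where "m = length init"
  have valid: "\<And>i. i < m \<Longrightarrow> polyomino (init ! i)" "feasible F init" "p < m" "placement_of (init ! p) goal"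
    using assms(1) unfolding I valid_instance_def m_def by auto
  have "\<exists>s l. 0 < l \<and> init ! i = strip v c ` {s..<s + l}" if "i < m" for i
  proof -
    have "init ! i \<subseteq> strip v c ` {..<n}"
      using valid(2) that unfolding feasible_def F m_def by blast
    then show ?thesis using polyomino_in_strip[OF valid(1)[OF that]] by blast
  qed
  then have "\<forall>i. \<exists>s l. i < m \<longrightarrow> 0 < l \<and> init ! i = strip v c ` {s..<s + l}" by blast
  from choice[OF this] obtain s
    where "\<forall>i. \<exists>l. i < m \<longrightarrow> 0 < l \<and> init ! i = strip v c ` {s i..<s i + l}" by blast
  from choice[OF this] obtain l
    where sl: "\<And>i. i < m \<Longrightarrow> 0 < l i" "\<And>i. i < m \<Longrightarrow> init ! i = strip v c ` {s i..<s i + l i}" by blast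
  interpret strip_puzzle n m l v c
    by unfold_locales (use sl(1) valid(3) in auto)
  have init: "init = packing s"
  proof (rule nth_equalityI)
    show "length init = length (packing s)" by (simp only: length_packing) (simp only: m_def)
    show "init ! i = packing s ! i" if "i < length init" for i
      using sl(2)[of i] that by (simp add: packing_nth segment_def m_def[symmetric])
  qed
  have F': "F = frame" unfolding F frame_def ..
  have "fits s" using valid(2) unfolding F' init feasible_iff .
  then show ?thesis
    using accepts_iff_solvable[of s p goal] valid unfolding I F' init by blast
qed

theorem theorem11:
  shows "\<exists>M :: tm. \<exists>c k :: nat. tm_wf M \<and>
    (\<forall>I. valid_instance I \<and> width1_rectangle (fst I) \<longrightarrow>
       tm_answers_within M (enc_instance I) (c * (length (enc_instance I) + 1) ^ k) (solvable I))"
proof -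
  have "decidable (\<lambda>e. accepts (bits e))"
    using decidable_accepts[where ?'a = word] unfolding input_word_def .
  then obtain prog where prog:
    "\<And>w. w \<noteq> [] \<Longrightarrow> \<exists>\<sigma>'. run w prog (\<lambda>_. 0) \<sigma>' \<and> (\<sigma>' 0 \<noteq> 0 \<longleftrightarrow> accepts w)"
    using computable_program[of accepts] by blast
  obtain M c k where M: "tm_wf M"
    "\<And>w. w \<noteq> [] \<Longrightarrow> tm_answers_within M w (c * (length w + 1) ^ k) (accepts w)"
    using program_decided_in_polynomial_time[OF prog] by blast
  have "enc_instance I \<noteq> []" for I
    by (cases I) (simp add: enc_instance_def enc_cellset_def enc_list_def)
  then have "tm_answers_within M (enc_instance I) (c * (length (enc_instance I) + 1) ^ k) (solvable I)"
    if "valid_instance I" "width1_rectangle (fst I)" for I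
    using M(2)[of "enc_instance I"] accepts_iff[OF that] by simp
  then show ?thesis using M(1) by blast
qed

end
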